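(* Let $V$ be a real reflexive Banach space, $X$ a real Banach space, $\gamma\in\mathcal{L}(V,X)$ with $c_\gamma:=\|\gamma\|_{\mathcal{L}(V,X)}$, $T>0$, and $u_0\in V$. Let $A,B\colon V\to V^*$, $J\colon X\times X\to\mathbb{R}$, $f\colon[0,T]\to V^*$ satisfy: (A) $A$ is linear and bounded, symmetric, and there is $m_A>0$ with $\langle Au,u\rangle_{V^*\times V}\ge m_A\|u\|_V^2$ for all $u\in V$; (B) there is $L_B>0$ with $\|Bv-Bw\|_{V^*}\le L_B\|v-w\|_V$ for all $v,w\in V$; (J) $J(w,\cdot)$ is locally Lipschitz continuous for all $w\in X$; there are $c_0,c_1,c_2\ge 0$ such that $\|\partial_2J(w,v)\|_{X^*}\le c_0+c_1\|w\|_X+c_2\|v\|_X$ for all $w,v\in X$; and there are $m_{J1},m_{J2}\ge0$ such that $$J_2^0(w_1,v_1;v_2-v_1)+J_2^0(w_2,v_2;v_1-v_2)\le m_{J1}\|v_1-v_2\|_X^2+m_{J2}\|w_1-w_2\|_X\|v_1-v_2\|_X$$ for all $w_1,w_2,v_1,v_2\in X$; (f) $f\in C([0,T];V^* )$; (s) $m_A-2m_{J1}c_\gamma^2>0$. Let $(Kv)(t)=\int_0^tv(s)\,ds+u_0$ and let $v\in C([0,T];V)$ be the unique solution of: for all $t\in[0,T]$, $$\langle Av(t)+B(Kv)(t),w\rangle_{V^*\times V}+J_2^0(\gamma(Kv)(t),\gamma v(t);\gamma w)\ge\langle f(t),w\rangle_{V^*\times V}\quad\forall\,w\in V.$$ Let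 $V^h\subset V$ be a finite dimensional subspace, $u_0^h\in V^h$, $N\in\mathbb{N}$, $k=T/N$, $t_j=jk$, and write $v_j=v(t_j)$, $f_j=f(t_j)$, $(Kv)_j=(Kv)(t_j)$. Let $v^{hk}=\{v_j^{hk}\}_{j=1}^N\subset V^h$ be the unique solution of the discrete problem: $0\in\partial\mathcal{L}_j(v_j^{hk})$ for $j=1,\dots,N$, where $\mathcal{L}_j\colon V^h\to\mathbb{R}$, $$\mathcal{L}_j(w)=\tfrac12\langle Aw,w\rangle_{V^*\times V}+\langle B(K^kv^{hk})_{j-1}-f_j,w\rangle_{V^*\times V}+J(\gamma(K^kv^{hk})_{j-1},\gamma w),$$ with $(K^kv^{hk})_0=u_0^h$ and $(K^kv^{hk})_j=k\sum_{i=1}^jv_i^{hk}+u_0^h$. Assume additionally that $v\in W^{1,\infty}(0,T;V)$. Then there exists a constant $c>0$, independent of $k$ and $h$ (i.e. of $N$ and $V^h$), such that $$\max_{1\le j\le N}\|v_j-v_j^{hk}\|_V^2\le c\max_{1\le j\le N}\inf_{w^h\in V^h}\Big\{k^2+\|v_j-w^h\|_V^2+\|\gamma v_j-\gamma w^h\|_X+|R_j(v_j-w^h)|\Big\}+c\,\|u_0-u_0^h\|_V^2,$$ where $$R_j(w)=\langle Av_j,w\rangle_{V^*\times V}+\langle B(Kv)_j,w\rangle_{V^*\times V}-\langle f_j,w\rangle_{V^*\times V}.$$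
   Context: $V^*$ is the dual of $V$ and $\langle\cdot,\cdot\rangle_{V^*\times V}$ the duality pairing. For a locally Lipschitz $j\colon X\to\mathbb{R}$ on a normed space, $j^0(x;v)=\limsup_{y\to x,\lambda\searrow0}\frac{j(y+\lambda v)-j(y)}{\lambda}$ and $\partial j(x)=\{\xi\in X^*:\langle\xi,v\rangle_{X^*\times X}\le j^0(x;v)\ \forall v\in X\}$ (Clarke subdifferential). For $J\colon X\times X\to\mathbb{R}$, $J_2^0(w,v;z)$ and $\partial_2J(w,v)$ are the generalized directional derivative at $v$ in direction $z$, and the subdifferential at $v$, of $J(w,\cdot)$. A bound $\|\partial_2J(w,v)\|_{X^*}\le C$ means $\|\xi\|_{X^*}\le C$ for every $\xi\in\partial_2J(w,v)$. Symmetric means $\langle Au,v\rangle_{V^*\times V}=\langle Av,u\rangle_{V^*\times V}$ for all $u,v\in V$. Under the stated assumptions both the continuous and the discrete problem have unique solutions. The spaces $V^h$ form a family indexed by a discretization parameter $h>0$, and $u_0^h\in V^h$ is an approximation of $u_0$, bounded in $V$ uniformly in $h$. The constant $c$ may depend on the data $A,B,J,\gamma,f,u_0,T$, on the solution $v$, and on the uniform bound for $\|u_0^h\|_V$. *)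

theory Defs
  imports "HOL-Analysis.Analysis"
begin

text \<open>The dual of a normed space \<^typ>\<open>'a\<close> is \<^typ>\<open>'a \<Rightarrow>\<^sub>L real\<close> with the operator norm, and the duality
  pairing of \<open>\<xi>\<close> and \<open>x\<close> is \<open>blinfun_apply \<xi> x\<close>.\<close>

definition reflexive_space :: "'a::real_normed_vector itself \<Rightarrow> bool" where
  "reflexive_space _ \<longleftrightarrow>
     (\<forall>\<Phi> :: ('a \<Rightarrow>\<^sub>L real) \<Rightarrow>\<^sub>L real. \<exists>x::'a. \<forall>\<xi>. blinfun_apply \<Phi> \<xi> = blinfun_apply \<xi> x)"

definition finite_dim_subspace :: "'a::real_vector set \<Rightarrow> bool" where
  "finite_dim_subspace S \<longleftrightarrow> (\<exists>b. finite b \<and> S = span b)"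


subsection \<open>Clarke subdifferential\<close>

text \<open>The notions are relative to a linear subspace \<open>S\<close>, regarded as a normed space in its own right,
  so that they also apply to functionals defined on \<open>V\<^sup>h\<close> only; the case \<open>S = UNIV\<close> is the usual one.\<close>

definition locally_lipschitz_on :: "'a::metric_space set \<Rightarrow> ('a \<Rightarrow> real) \<Rightarrow> bool" where
  "locally_lipschitz_on S j \<longleftrightarrow> (\<forall>x\<in>S. \<exists>e>0. \<exists>L. L-lipschitz_on (ball x e \<inter> S) j)"

text \<open>The upper limit over \<open>y \<rightarrow> x\<close> within \<open>S\<close> and \<open>\<lambda> \<searrow> 0\<close>, where \<open>y = x\<close> is allowed.
  It is taken in the extended reals; for locally Lipschitz \<open>j\<close> it is finite (see
  \<open>ereal_clarke_dderiv_on\<close> below), so the conversion to \<^typ>\<open>real\<close> loses nothing.\<close>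

definition clarke_dderiv_on ::
    "'a::real_normed_vector set \<Rightarrow> ('a \<Rightarrow> real) \<Rightarrow> 'a \<Rightarrow> 'a \<Rightarrow> real" where
  "clarke_dderiv_on S j x v =
     real_of_ereal (Limsup (inf (nhds x) (principal S) \<times>\<^sub>F at_right 0)
       (\<lambda>(y, l). ereal ((j (y + l *\<^sub>R v) - j y) / l)))"

abbreviation clarke_dderiv :: "('a::real_normed_vector \<Rightarrow> real) \<Rightarrow> 'a \<Rightarrow> 'a \<Rightarrow> real" where
  "clarke_dderiv \<equiv> clarke_dderiv_on UNIV"

definition clarke_subdiff :: "('a::real_normed_vector \<Rightarrow> real) \<Rightarrow> 'a \<Rightarrow> ('a \<Rightarrow>\<^sub>L real) set" where
  "clarke_subdiff j x = {\<xi>. \<forall>v. blinfun_apply \<xi> v \<le> clarke_dderiv j x v}"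

text \<open>Bounded linear functionals on the subspace \<open>S\<close>, represented uniquely by functions that vanish
  outside \<open>S\<close>; the zero functional is \<open>\<lambda>_. 0\<close>.\<close>

definition dual_on :: "'a::real_normed_vector set \<Rightarrow> ('a \<Rightarrow> real) set" where
  "dual_on S = {\<xi>. (\<forall>x\<in>S. \<forall>y\<in>S. \<xi> (x + y) = \<xi> x + \<xi> y) \<and> (\<forall>a. \<forall>x\<in>S. \<xi> (a *\<^sub>R x) = a * \<xi> x) \<and>
                   (\<exists>C. \<forall>x\<in>S. \<bar>\<xi> x\<bar> \<le> C * norm x) \<and> (\<forall>x. x \<notin> S \<longrightarrow> \<xi> x = 0)}"

definition clarke_subdiff_on ::
    "'a::real_normed_vector set \<Rightarrow> ('a \<Rightarrow> real) \<Rightarrow> 'a \<Rightarrow> ('a \<Rightarrow> real) set" where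
  "clarke_subdiff_on S j x = {\<xi> \<in> dual_on S. \<forall>v\<in>S. \<xi> v \<le> clarke_dderiv_on S j x v}"

lemma ereal_clarke_dderiv_on:
  fixes j :: "'a::real_normed_vector \<Rightarrow> real"
  assumes "locally_lipschitz_on S j" "subspace S" "x \<in> S" "v \<in> S"
  shows "ereal (clarke_dderiv_on S j x v) =
    Limsup (inf (nhds x) (principal S) \<times>\<^sub>F at_right 0)
      (\<lambda>(y, l). ereal ((j (y + l *\<^sub>R v) - j y) / l))"
proof -
  define F where "F = inf (nhds x) (principal S) \<times>\<^sub>F at_right (0::real)"
  define q where "q = (\<lambda>(y, l). ereal ((j (y + l *\<^sub>R v) - j y) / l))"
  obtain e L where e: "e > 0" and L: "L-lipschitz_on (ball x e \<inter> S) j"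
    using assms(1,3) by (auto simp: locally_lipschitz_on_def)
  define d where "d = e / (2 * (norm v + 1))"
  have d: "d > 0"
    using e by (simp add: d_def add_nonneg_pos)
  have ev1: "eventually (\<lambda>y. y \<in> ball x (e/2) \<and> y \<in> S) (inf (nhds x) (principal S))"
    unfolding eventually_inf_principal
    using eventually_nhds_in_open[of "ball x (e/2)" x] e by (auto elim!: eventually_mono)
  have ev2: "eventually (\<lambda>l. l \<in> {0<..<d}) (at_right (0::real))"
    using d by (rule eventually_at_right_real)
  have bound: "\<bar>(j (y + l *\<^sub>R v) - j y) / l\<bar> \<le> L * norm v"
    if "y \<in> ball x (e/2)" "y \<in> S" "l \<in> {0<..<d}" for y l
  proof -
    have l: "0 < l" "l < d"
      using that by auto
    have "l * norm v \<le> d * norm v"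
      using l by (intro mult_right_mono) auto
    also have "\<dots> \<le> d * (norm v + 1)"
      using d by simp
    also have "\<dots> = e / 2"
      by (simp add: d_def divide_simps) (smt (verit) norm_ge_zero)
    finally have lv: "l * norm v \<le> e / 2" .
    have "dist x (y + l *\<^sub>R v) \<le> dist x y + l * norm v"
      using l dist_triangle[of x "y + l *\<^sub>R v" y] by (simp add: dist_norm)
    also have "\<dots> < e"
      using lv that(1) by simp
    finally have "y + l *\<^sub>R v \<in> ball x e \<inter> S"
      using assms(2,4) that(2) by (auto intro: subspace_add subspace_scale)
    moreover have "y \<in> ball x e \<inter> S"
      using that e by auto
    ultimately have "\<bar>j (y + l *\<^sub>R v) - j y\<bar> \<le> L * (l * norm v)"
      using lipschitz_onD[OF L, of "y + l *\<^sub>R v" y] l by (simp add: dist_norm)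
    thus ?thesis
      using l by (simp add: abs_mult divide_simps mult.assoc mult.commute mult.left_commute)
  qed
  have "- ereal (L * norm v) \<le> q (y, l) \<and> q (y, l) \<le> ereal (L * norm v)"
    if "y \<in> ball x (e/2) \<and> y \<in> S" "l \<in> {0<..<d}" for y l
    using bound[of y l] that unfolding q_def abs_le_iff by simp
  hence ev: "eventually (\<lambda>p. - ereal (L * norm v) \<le> q p \<and> q p \<le> ereal (L * norm v)) F"
    unfolding F_def eventually_prod_filter using ev1 ev2 by blast
  have "inf (nhds x) (principal S) \<noteq> bot"
    using assms(3) by (auto simp: trivial_limit_def eventually_inf_principal dest: eventually_nhds_x_imp_x)
  hence F: "F \<noteq> bot"
    by (simp add: F_def prod_filter_eq_bot)
  have "Limsup F q \<le> ereal (L * norm v)"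
    using ev by (intro Limsup_bounded) (auto elim: eventually_mono)
  moreover have "- ereal (L * norm v) \<le> Limsup F q"
    using ev by (intro le_Limsup F) (auto elim: eventually_mono)
  ultimately have "\<bar>Limsup F q\<bar> \<noteq> \<infinity>"
    by auto
  thus ?thesis
    unfolding clarke_dderiv_on_def F_def q_def by (simp add: ereal_real')
qed

lemma clarke_subdiff_eq_clarke_subdiff_on_UNIV:
  "blinfun_apply ` clarke_subdiff j x = clarke_subdiff_on UNIV j x"
proof (intro equalityI subsetI)
  fix \<xi> assume "\<xi> \<in> clarke_subdiff_on UNIV j x"
  hence *: "\<xi> \<in> dual_on UNIV" "\<And>v. \<xi> v \<le> clarke_dderiv j x v"
    by (auto simp: clarke_subdiff_on_def)
  from *(1) obtain C where C: "\<And>x. \<bar>\<xi> x\<bar> \<le> C * norm x"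
    unfolding dual_on_def by auto
  have "bounded_linear \<xi>"
    using *(1) C unfolding dual_on_def
    by (intro bounded_linear_intro[where K = C]) (auto simp: mult.commute)
  hence eq: "blinfun_apply (Blinfun \<xi>) = \<xi>"
    by (rule bounded_linear_Blinfun_apply)
  hence "Blinfun \<xi> \<in> clarke_subdiff j x"
    using *(2) by (simp add: clarke_subdiff_def)
  thus "\<xi> \<in> blinfun_apply ` clarke_subdiff j x"
    using eq by (intro image_eqI[where x = "Blinfun \<xi>"]) simp_all
next
  fix \<xi> assume "\<xi> \<in> blinfun_apply ` clarke_subdiff j x"
  then obtain \<eta> where \<eta>: "\<xi> = blinfun_apply \<eta>" "\<And>v. blinfun_apply \<eta> v \<le> clarke_dderiv j x v"
    by (auto simp: clarke_subdiff_def)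
  have "\<exists>C. \<forall>x. \<bar>blinfun_apply \<eta> x\<bar> \<le> C * norm x"
    using norm_blinfun[of \<eta>] by (intro exI[of _ "norm \<eta>"]) auto
  thus "\<xi> \<in> clarke_subdiff_on UNIV j x"
    using \<eta> by (auto simp: clarke_subdiff_on_def dual_on_def blinfun.add_right blinfun.scaleR_right)
qed


subsection \<open>The space $W^{1,\infty}(a,b;V)$\<close>

text \<open>The Bochner integral of the library requires a second countable range. Strongly measurable,
  essentially bounded functions on a bounded interval are Henstock-Kurzweil integrable with the same
  integral for every Banach space, so \<^const>\<open>has_integral\<close> is used for the integrals below.\<close>

definition strongly_measurable_on :: "real set \<Rightarrow> (real \<Rightarrow> 'a::real_normed_vector) \<Rightarrow> bool" where
  "strongly_measurable_on I g \<longleftrightarrow>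
     (\<exists>s :: nat \<Rightarrow> real \<Rightarrow> 'a. (\<forall>n. simple_function (lebesgue_on I) (s n)) \<and>
        (AE t in lebesgue_on I. (\<lambda>n. s n t) \<longlonglongrightarrow> g t))"

definition Linfty_on :: "real set \<Rightarrow> (real \<Rightarrow> 'a::real_normed_vector) \<Rightarrow> bool" where
  "Linfty_on I g \<longleftrightarrow>
     strongly_measurable_on I g \<and> (\<exists>C. AE t in lebesgue_on I. norm (g t) \<le> C)"

definition test_function :: "real \<Rightarrow> real \<Rightarrow> (real \<Rightarrow> real) \<Rightarrow> bool" where
  "test_function a b \<phi> \<longleftrightarrow>
     (\<forall>n t. (deriv ^^ n) \<phi> differentiable (at t)) \<and>
     compact (closure {t. \<phi> t \<noteq> 0}) \<and> closure {t. \<phi> t \<noteq> 0} \<subseteq> {a<..<b}"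

definition weak_derivative_on ::
    "real \<Rightarrow> real \<Rightarrow> (real \<Rightarrow> 'a::real_normed_vector) \<Rightarrow> (real \<Rightarrow> 'a) \<Rightarrow> bool" where
  "weak_derivative_on a b v g \<longleftrightarrow>
     (\<forall>\<phi>. test_function a b \<phi> \<longrightarrow>
        (\<exists>I. ((\<lambda>t. deriv \<phi> t *\<^sub>R v t) has_integral I) {a..b} \<and>
             ((\<lambda>t. \<phi> t *\<^sub>R g t) has_integral - I) {a..b}))"

definition W1infty :: "real \<Rightarrow> real \<Rightarrow> (real \<Rightarrow> 'a::real_normed_vector) \<Rightarrow> bool" where
  "W1infty a b v \<longleftrightarrow>
     Linfty_on {a<..<b} v \<and> (\<exists>g. Linfty_on {a<..<b} g \<and> weak_derivative_on a b v g)"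


subsection \<open>The continuous and the discrete problem\<close>

definition Kop :: "'v::banach \<Rightarrow> (real \<Rightarrow> 'v) \<Rightarrow> real \<Rightarrow> 'v" where
  "Kop u0 v t = integral {0..t} v + u0"

definition continuous_solution ::
    "('v::banach \<Rightarrow> 'v \<Rightarrow>\<^sub>L real) \<Rightarrow> ('v \<Rightarrow> 'v \<Rightarrow>\<^sub>L real) \<Rightarrow> ('x::banach \<Rightarrow> 'x \<Rightarrow> real) \<Rightarrow>
     ('v \<Rightarrow>\<^sub>L 'x) \<Rightarrow> (real \<Rightarrow> 'v \<Rightarrow>\<^sub>L real) \<Rightarrow> 'v \<Rightarrow> real \<Rightarrow> (real \<Rightarrow> 'v) \<Rightarrow> bool" where
  "continuous_solution A B J \<gamma> f u0 T v \<longleftrightarrow>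
     continuous_on {0..T} v \<and>
     (\<forall>t\<in>{0..T}. \<forall>w.
        blinfun_apply (A (v t) + B (Kop u0 v t)) w
          + clarke_dderiv (J (blinfun_apply \<gamma> (Kop u0 v t))) (blinfun_apply \<gamma> (v t)) (blinfun_apply \<gamma> w)
        \<ge> blinfun_apply (f t) w)"

definition Kdisc :: "real \<Rightarrow> 'v::real_vector \<Rightarrow> (nat \<Rightarrow> 'v) \<Rightarrow> nat \<Rightarrow> 'v" where
  "Kdisc k u0h vh j = k *\<^sub>R (\<Sum>i=1..j. vh i) + u0h"

definition Ldisc ::
    "('v::banach \<Rightarrow> 'v \<Rightarrow>\<^sub>L real) \<Rightarrow> ('v \<Rightarrow> 'v \<Rightarrow>\<^sub>L real) \<Rightarrow> ('x::banach \<Rightarrow> 'x \<Rightarrow> real) \<Rightarrow>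
     ('v \<Rightarrow>\<^sub>L 'x) \<Rightarrow> (real \<Rightarrow> 'v \<Rightarrow>\<^sub>L real) \<Rightarrow> real \<Rightarrow> 'v \<Rightarrow> (nat \<Rightarrow> 'v) \<Rightarrow> nat \<Rightarrow> 'v \<Rightarrow> real" where
  "Ldisc A B J \<gamma> f k u0h vh j w =
     1 / 2 * blinfun_apply (A w) w
     + blinfun_apply (B (Kdisc k u0h vh (j - 1)) - f (real j * k)) w
     + J (blinfun_apply \<gamma> (Kdisc k u0h vh (j - 1))) (blinfun_apply \<gamma> w)"

text \<open>Only the values \<open>vh 1, \<dots>, vh N\<close> matter.\<close>

definition discrete_solution ::
    "('v::banach \<Rightarrow> 'v \<Rightarrow>\<^sub>L real) \<Rightarrow> ('v \<Rightarrow> 'v \<Rightarrow>\<^sub>L real) \<Rightarrow> ('x::banach \<Rightarrow> 'x \<Rightarrow> real) \<Rightarrow>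
     ('v \<Rightarrow>\<^sub>L 'x) \<Rightarrow> (real \<Rightarrow> 'v \<Rightarrow>\<^sub>L real) \<Rightarrow> 'v set \<Rightarrow> real \<Rightarrow> nat \<Rightarrow> 'v \<Rightarrow> (nat \<Rightarrow> 'v) \<Rightarrow> bool" where
  "discrete_solution A B J \<gamma> f Vh k N u0h vh \<longleftrightarrow>
     (\<forall>j\<in>{1..N}. vh j \<in> Vh \<and>
        (\<lambda>_. 0) \<in> clarke_subdiff_on Vh (Ldisc A B J \<gamma> f k u0h vh j) (vh j))"

definition Rres ::
    "('v::banach \<Rightarrow> 'v \<Rightarrow>\<^sub>L real) \<Rightarrow> ('v \<Rightarrow> 'v \<Rightarrow>\<^sub>L real) \<Rightarrow> (real \<Rightarrow> 'v \<Rightarrow>\<^sub>L real) \<Rightarrow>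
     'v \<Rightarrow> (real \<Rightarrow> 'v) \<Rightarrow> real \<Rightarrow> nat \<Rightarrow> 'v \<Rightarrow> real" where
  "Rres A B f u0 v k j w =
     blinfun_apply (A (v (real j * k))) w
     + blinfun_apply (B (Kop u0 v (real j * k))) w
     - blinfun_apply (f (real j * k)) w"

end

theory Submission
  imports Defs "HOL-Computational_Algebra.Polynomial"
begin

text \<open>The error of the scheme at time \<open>t\<^sub>j\<close> is compared with the error of an arbitrary element \<open>w\<close> of
  the subspace. Write \<open>e\<^sub>j\<close> for the norm of \<open>v(t\<^sub>j) - v\<^sub>j\<^sup>h\<^sup>k\<close> and \<open>D\<^sub>j\<close> for the norm of the error
  \<open>(Kv)\<^sub>j - (K\<^sup>kv\<^sup>h\<^sup>k)\<^sub>j\<^sub>-\<^sub>1\<close> of the history. Coercivity of \<open>A\<close>, the continuous inequality tested with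
  \<open>v\<^sub>j\<^sup>h\<^sup>k - v(t\<^sub>j)\<close>, the discrete inequality tested with \<open>w - v\<^sub>j\<^sup>h\<^sup>k\<close> and the one-sided Lipschitz
  condition on the generalized derivatives of \<open>J\<close> give (\<open>galerkin_error_inequality\<close>)

  \<open>(m\<^sub>A - m\<^sub>J\<^sub>1 c\<^sub>\<gamma>\<^sup>2) e\<^sub>j\<^sup>2 \<le> \<close> products of \<open>e\<^sub>j\<close>, \<open>D\<^sub>j\<close> and \<open>\<parallel>v(t\<^sub>j) - w\<parallel>\<close>, plus
  \<open>\<kappa> \<parallel>\<gamma> v(t\<^sub>j) - \<gamma> w\<parallel> + |R\<^sub>j(v(t\<^sub>j) - w)|\<close>.

  The smallness condition makes the coefficient on the left positive, so the products with \<open>e\<^sub>j\<close> can be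
  absorbed (\<open>young_absorption\<close>). The constant \<open>\<kappa>\<close> grows with the discrete solution; replacing the discrete
  solution by the exact one changes it by multiples of \<open>e\<^sub>j\<close> and \<open>D\<^sub>j\<close>, which yields further products of
  the same kind. Hence \<open>e\<^sub>j\<^sup>2\<close> is bounded by the approximation error of \<open>w\<close> and \<open>D\<^sub>j\<^sup>2\<close>. Since \<open>v\<close> is
  Lipschitz continuous, \<open>D\<^sub>j\<close> is at most \<open>\<parallel>u\<^sub>0 - u\<^sub>0\<^sup>h\<parallel> + C k + k (e\<^sub>1 + \<dots> + e\<^sub>j\<^sub>-\<^sub>1)\<close>
  (\<open>Kop_Kdisc_error\<close>), and \<open>discrete_gronwall\<close> applied to the squares removes the sum.

  Two ingredients are less elementary. The growth condition bounds subgradients, while the argument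
  needs a bound of the generalized derivative. That the derivative is attained by a subgradient
  (\<open>clarke_subdiff_attains_dderiv\<close>) is the Hahn-Banach theorem, obtained from Zorn's lemma on sublinear
  functionals, whose minimal elements are linear. And the regularity of \<open>v\<close> is given by a weak derivative,
  from which Lipschitz continuity (\<open>W1infty_imp_lipschitz\<close>) follows by testing with smooth approximations
  of indicator functions of intervals, built from \<open>e\<^bsup>-1/x\<^esup>\<close>.\<close>

section \<open>Linear minorants of sublinear functionals\<close>

text \<open>Only one inequality is demanded for scaling: applied to \<open>inverse a\<close> it yields the other one,
  and it forces \<open>p 0 = 0\<close>.\<close>

definition sublinear :: "('a::real_vector \<Rightarrow> real) \<Rightarrow> bool" where
  "sublinear p \<longleftrightarrow> (\<forall>x y. p (x + y) \<le> p x + p y) \<and> (\<forall>a>0. \<forall>x. p (a *\<^sub>R x) \<le> a * p x)"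

lemma sublinear_add: "sublinear p \<Longrightarrow> p (x + y) \<le> p x + p y"
  by (simp add: sublinear_def)

lemma sublinear_zero:
  assumes "sublinear p"
  shows "p 0 = 0"
proof -
  have "p ((1/2) *\<^sub>R 0) \<le> 1/2 * p 0"
    using assms unfolding sublinear_def by (metis half_gt_zero_iff zero_less_one)
  moreover have "p (0 + 0) \<le> p 0 + p 0"
    using assms unfolding sublinear_def by metis
  ultimately show ?thesis by simp
qed

lemma sublinear_scaleR:
  assumes "sublinear p" "a \<ge> 0"
  shows "p (a *\<^sub>R x) = a * p x"
proof (cases "a = 0")
  case True
  thus ?thesis using sublinear_zero[OF assms(1)] by simp
next
  case False
  hence a: "a > 0" using assms by simp
  have le: "p (a *\<^sub>R x) \<le> a * p x" if "a > 0" for a x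
    using assms(1) that by (simp add: sublinear_def)
  have "p (inverse a *\<^sub>R (a *\<^sub>R x)) \<le> inverse a * p (a *\<^sub>R x)"
    using a by (intro le) simp
  hence "a * p x \<le> p (a *\<^sub>R x)"
    using a by (simp add: field_simps)
  with le[OF a, of x] show ?thesis by simp
qed

lemma sublinear_ge_uminus:
  assumes "sublinear p"
  shows "- p (- x) \<le> p x"
  using sublinear_add[OF assms, of x "- x"] sublinear_zero[OF assms] by simp

text \<open>The pointwise infimum of a chain is finite because every member \<open>q\<close> satisfies
  \<open>q x \<ge> - q (- x) \<ge> - p (- x)\<close>. It is subadditive because two members of the chain can be replaced by the
  smaller one, which estimates both summands at once. This is the hypothesis of Zorn's lemma below.\<close>

lemma sublinear_chain_lower_bound:
  fixes p :: "'a::real_vector \<Rightarrow> real"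
  assumes C: "C \<noteq> {}" "\<And>q. q \<in> C \<Longrightarrow> sublinear q \<and> q \<le> p"
    and chain: "\<And>q r. q \<in> C \<Longrightarrow> r \<in> C \<Longrightarrow> q \<le> r \<or> r \<le> q"
  shows "\<exists>u. sublinear u \<and> (\<forall>q\<in>C. u \<le> q)"
proof -
  define u where "u x = (INF q\<in>C. q x)" for x
  have "- p (- x) \<le> q x" if "q \<in> C" for q x
    using C(2)[OF that] sublinear_ge_uminus[of q x] by (smt (verit) le_funD)
  hence le: "u x \<le> q x" if "q \<in> C" for q x
    unfolding u_def using that by (intro cINF_lower bdd_belowI2[where m = "- p (- x)"]) auto
  have ge: "b \<le> u x" if "\<And>q. q \<in> C \<Longrightarrow> b \<le> q x" for b x
    unfolding u_def using that C(1) by (intro cINF_greatest) auto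
  have both: "u (x + y) \<le> q x + r y" if qr: "q \<in> C" "r \<in> C" for q r x y
  proof -
    obtain s where s: "s \<in> C" "s \<le> q" "s \<le> r"
      using chain[OF qr] qr by auto
    have "u (x + y) \<le> s (x + y)" using le[OF s(1)] .
    also have "\<dots> \<le> s x + s y" using C(2)[OF s(1)] by (simp add: sublinear_add)
    also have "\<dots> \<le> q x + r y" using s by (intro add_mono) (auto dest: le_funD)
    finally show ?thesis .
  qed
  have "u (x + y) \<le> u x + u y" for x y
  proof -
    have "u (x + y) - r y \<le> u x" if "r \<in> C" for r
      by (rule ge) (use both[OF _ that, of _ x y] in \<open>auto simp: algebra_simps\<close>)
    hence "u (x + y) - u x \<le> u y"
      by (intro ge) (auto simp: algebra_simps)
    thus ?thesis by simp
  qed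
  moreover have "u (a *\<^sub>R x) \<le> a * u x" if a: "a > 0" for a x
  proof -
    have "u (a *\<^sub>R x) / a \<le> u x"
    proof (rule ge)
      fix q assume q: "q \<in> C"
      have "u (a *\<^sub>R x) \<le> a * q x"
        using le[OF q, of "a *\<^sub>R x"] C(2)[OF q] sublinear_scaleR[of q a x] a by simp
      thus "u (a *\<^sub>R x) / a \<le> q x" using a by (simp add: field_simps)
    qed
    thus ?thesis using a by (simp add: field_simps)
  qed
  ultimately have "sublinear u" by (simp add: sublinear_def)
  thus ?thesis using le by (auto simp: le_fun_def)
qed

text \<open>Every sublinear functional has a sublinear minorant for which \<open>x\<close> and \<open>- x\<close> have opposite
  values. It is \<open>q y = inf {p (y + t x) - t (p x) | t \<ge> 0}\<close>, the largest sublinear functional below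
  \<open>p\<close> with \<open>q (- x) \<le> - p x\<close>: passing from \<open>p\<close> to \<open>q\<close> makes the functional linear on the line
  through \<open>x\<close> and keeps its value at \<open>x\<close>.\<close>

lemma sublinear_tilt:
  fixes p :: "'a::real_vector \<Rightarrow> real"
  assumes p: "sublinear p"
  shows "\<exists>q. sublinear q \<and> q \<le> p \<and> q (- x) = - p x"
proof -
  define q where "q y = (INF t\<in>{0..}. p (y + t *\<^sub>R x) - t * p x)" for y
  have lb: "- p (- y) \<le> p (y + t *\<^sub>R x) - t * p x" if "t \<ge> 0" for y t
    using sublinear_add[OF p, of "y + t *\<^sub>R x" "- y"] sublinear_scaleR[OF p that, of x] by simp
  have le: "q y \<le> p (y + t *\<^sub>R x) - t * p x" if "t \<ge> 0" for y t
    unfolding q_def using that lb by (intro cINF_lower bdd_belowI2[where m = "- p (- y)"]) auto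
  have ge: "b \<le> q y" if "\<And>t. t \<ge> 0 \<Longrightarrow> b \<le> p (y + t *\<^sub>R x) - t * p x" for b y
    unfolding q_def using that by (intro cINF_greatest) auto
  have both: "q (y + z) \<le> (p (y + t *\<^sub>R x) - t * p x) + (p (z + s *\<^sub>R x) - s * p x)"
    if "t \<ge> 0" "s \<ge> 0" for y z s t
  proof -
    have "q (y + z) \<le> p ((y + z) + (t + s) *\<^sub>R x) - (t + s) * p x"
      using that by (intro le) simp
    also have "(y + z) + (t + s) *\<^sub>R x = (y + t *\<^sub>R x) + (z + s *\<^sub>R x)"
      by (simp add: algebra_simps)
    finally show ?thesis
      using sublinear_add[OF p, of "y + t *\<^sub>R x" "z + s *\<^sub>R x"] by (simp add: algebra_simps)
  qed
  have "q (y + z) \<le> q y + q z" for y z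
  proof -
    have "q (y + z) - (p (z + s *\<^sub>R x) - s * p x) \<le> q y" if "s \<ge> 0" for s
      by (rule ge) (use both[OF _ that, of _ y z] in \<open>simp add: algebra_simps\<close>)
    hence "q (y + z) - q y \<le> q z"
      by (intro ge) (simp add: algebra_simps)
    thus ?thesis by simp
  qed
  moreover have "q (a *\<^sub>R y) \<le> a * q y" if a: "a > 0" for a y
  proof -
    have "q (a *\<^sub>R y) / a \<le> q y"
    proof (rule ge)
      fix t :: real assume t: "t \<ge> 0"
      have "q (a *\<^sub>R y) \<le> p (a *\<^sub>R y + (a * t) *\<^sub>R x) - (a * t) * p x"
        using t a by (intro le) simp
      also have "a *\<^sub>R y + (a * t) *\<^sub>R x = a *\<^sub>R (y + t *\<^sub>R x)"
        by (simp add: algebra_simps)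
      also have "p \<dots> = a * p (y + t *\<^sub>R x)"
        using a by (intro sublinear_scaleR[OF p]) simp
      finally show "q (a *\<^sub>R y) / a \<le> p (y + t *\<^sub>R x) - t * p x"
        using a by (simp add: field_simps)
    qed
    thus ?thesis using a by (simp add: field_simps)
  qed
  ultimately have "sublinear q" by (simp add: sublinear_def)
  moreover have "q y \<le> p y" for y
    using le[of 0 y] by simp
  moreover have "q (- x) = - p x"
    using le[of 1 "- x"] ge[of "- p x" "- x"] lb[of _ "- x"] sublinear_zero[OF p] by force
  ultimately show ?thesis by (auto simp: le_fun_def)
qed

text \<open>A minimal functional equals each of its tilts, so it is odd, and an odd sublinear functional is
  linear.\<close>

lemma sublinear_minimal_imp_linear:
  fixes q :: "'a::real_vector \<Rightarrow> real"
  assumes q: "sublinear q" and min: "\<And>r. sublinear r \<Longrightarrow> r \<le> q \<Longrightarrow> r = q"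
  shows "linear q"
proof -
  have neg: "q (- x) = - q x" for x
    using sublinear_tilt[OF q, of x] min by metis
  show ?thesis
  proof (rule linearI)
    fix x y
    have "q (- (x + y)) \<le> q (- x) + q (- y)"
      using sublinear_add[OF q, of "- x" "- y"] by simp
    thus "q (x + y) = q x + q y"
      using sublinear_add[OF q, of x y] by (simp only: neg)
  next
    fix a x
    show "q (a *\<^sub>R x) = a *\<^sub>R q x"
    proof (cases "a \<ge> 0")
      case True thus ?thesis by (simp add: sublinear_scaleR[OF q])
    next
      case False
      hence "q ((- a) *\<^sub>R x) = - a * q x" by (intro sublinear_scaleR[OF q]) simp
      thus ?thesis using neg[of "a *\<^sub>R x"] by simp
    qed
  qed
qed

lemma sublinear_linear_minorant:
  fixes p :: "'a::real_vector \<Rightarrow> real"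
  assumes p: "sublinear p"
  shows "\<exists>\<xi>. linear \<xi> \<and> \<xi> \<le> p"
proof -
  define A where "A = {q. sublinear q \<and> q \<le> p}"
  define P where "P = (\<lambda>q r :: 'a \<Rightarrow> real. r \<le> q)"
  have "\<exists>m\<in>A. \<forall>a\<in>A. P m a \<longrightarrow> a = m"
  proof (rule predicate_Zorn)
    show "partial_order_on A (relation_of P A)"
      unfolding P_def by (rule partial_order_on_relation_ofI) auto
  next
    fix C assume C: "C \<in> Chains (relation_of P A)"
    hence CA: "q \<in> A" if "q \<in> C" for q
      using that unfolding Chains_def relation_of_def by blast
    show "\<exists>u\<in>A. \<forall>a\<in>C. P a u"
    proof (cases "C = {}")
      case True
      thus ?thesis using p by (auto simp: A_def)
    next
      case False
      have "\<exists>u. sublinear u \<and> (\<forall>q\<in>C. u \<le> q)"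
        using False CA C
        by (intro sublinear_chain_lower_bound[where p = p])
           (auto simp: A_def P_def Chains_def relation_of_def)
      then obtain u where u: "sublinear u" "\<And>q. q \<in> C \<Longrightarrow> u \<le> q" by blast
      obtain q where "q \<in> C" using False by blast
      hence "u \<in> A" using u CA[of q] by (auto simp: A_def intro: order_trans)
      thus ?thesis using u by (auto simp: P_def)
    qed
  qed
  then obtain m where m: "m \<in> A" "\<And>a. a \<in> A \<Longrightarrow> a \<le> m \<Longrightarrow> a = m"
    by (auto simp: P_def)
  have "linear m"
    using m by (intro sublinear_minimal_imp_linear) (auto simp: A_def intro: order_trans)
  thus ?thesis using m by (auto simp: A_def)
qed

text \<open>The Hahn-Banach theorem in the form used for Clarke's subdifferential: minorising the tilt of
  \<open>p\<close> at \<open>x\<close> instead of \<open>p\<close> itself forces equality at \<open>x\<close>.\<close>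

lemma sublinear_supporting_functional:
  fixes p :: "'a::real_vector \<Rightarrow> real"
  assumes p: "sublinear p"
  shows "\<exists>\<xi>. linear \<xi> \<and> \<xi> \<le> p \<and> \<xi> x = p x"
proof -
  obtain q where q: "sublinear q" "q \<le> p" "q (- x) = - p x"
    using sublinear_tilt[OF p] by blast
  obtain \<xi> where \<xi>: "linear \<xi>" "\<xi> \<le> q"
    using sublinear_linear_minorant[OF q(1)] by blast
  have "\<xi> (- x) \<le> - p x" using \<xi>(2) q(3) by (metis le_funD)
  hence "p x \<le> \<xi> x" using linear_neg[OF \<xi>(1), of x] by simp
  moreover have le: "\<xi> \<le> p" using \<xi>(2) q(2) by (rule order_trans)
  ultimately show ?thesis using \<xi>(1) le_funD[OF le, of x] by (intro exI[of _ \<xi>]) auto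
qed

section \<open>Clarke's generalized directional derivative\<close>

text \<open>The working characterisation of the generalized derivative: an upper limit is at most \<open>a\<close> iff
  the quotients are eventually below every \<open>b > a\<close>. All estimates of the derivative below are
  estimates of quotients.\<close>

lemma clarke_dderiv_on_le_iff:
  fixes j :: "'a::real_normed_vector \<Rightarrow> real"
  assumes "locally_lipschitz_on S j" "subspace S" "x \<in> S" "v \<in> S"
  shows "clarke_dderiv_on S j x v \<le> a \<longleftrightarrow>
    (\<forall>b>a. \<forall>\<^sub>F (y, l) in inf (nhds x) (principal S) \<times>\<^sub>F at_right 0.
       (j (y + l *\<^sub>R v) - j y) / l < b)" (is "_ \<longleftrightarrow> (\<forall>b>a. ?E b)")
proof -
  define F where "F = inf (nhds x) (principal S) \<times>\<^sub>F at_right (0::real)"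
  define q where "q = (\<lambda>(y, l). ereal ((j (y + l *\<^sub>R v) - j y) / l))"
  have "clarke_dderiv_on S j x v \<le> a \<longleftrightarrow> Limsup F q \<le> ereal a"
    unfolding F_def q_def ereal_clarke_dderiv_on[OF assms, symmetric] by simp
  also have "\<dots> \<longleftrightarrow> (\<forall>b>ereal a. eventually (\<lambda>p. q p < b) F)"
    by (rule Limsup_le_iff)
  also have "\<dots> \<longleftrightarrow> (\<forall>b>a. eventually (\<lambda>p. q p < ereal b) F)"
  proof (intro iffI allI impI)
    fix b :: ereal assume *: "\<forall>b>a. eventually (\<lambda>p. q p < ereal b) F" "ereal a < b"
    show "eventually (\<lambda>p. q p < b) F"
      using * by (cases b) (auto simp: q_def case_prod_unfold)
  qed auto
  finally show ?thesis
    unfolding F_def q_def by (simp add: case_prod_unfold)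
qed

lemma eventually_clarke_quotient_less:
  fixes j :: "'a::real_normed_vector \<Rightarrow> real"
  assumes "locally_lipschitz_on UNIV j" "clarke_dderiv j x v < b"
  shows "\<forall>\<^sub>F (y, l) in nhds x \<times>\<^sub>F at_right 0. (j (y + l *\<^sub>R v) - j y) / l < b"
  using clarke_dderiv_on_le_iff[OF assms(1) subspace_UNIV UNIV_I UNIV_I, of x v "clarke_dderiv j x v"]
    assms(2) by simp

lemma clarke_dderivI:
  fixes j :: "'a::real_normed_vector \<Rightarrow> real"
  assumes "locally_lipschitz_on UNIV j"
    and "\<And>b. b > a \<Longrightarrow> \<forall>\<^sub>F (y, l) in nhds x \<times>\<^sub>F at_right 0. (j (y + l *\<^sub>R v) - j y) / l < b"
  shows "clarke_dderiv j x v \<le> a"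
  using clarke_dderiv_on_le_iff[OF assms(1) subspace_UNIV UNIV_I UNIV_I, of x v a] assms(2) by simp

text \<open>The base points in the upper limit move freely near \<open>x\<close>, hence may be shifted by \<open>l w\<close>. This is
  what makes the generalized derivative subadditive in the direction, unlike a one-sided derivative at
  a fixed base point.\<close>

lemma filterlim_translate_ray:
  fixes x w :: "'a::real_normed_vector"
  shows "filterlim (\<lambda>(y, l). (y + l *\<^sub>R w, l)) (nhds x \<times>\<^sub>F at_right 0) (nhds x \<times>\<^sub>F at_right 0)"
proof -
  have f: "((\<lambda>p. fst p) \<longlongrightarrow> x) (nhds x \<times>\<^sub>F at_right (0::real))"
    by (rule filterlim_fst)
  have s: "filterlim (\<lambda>p. snd p) (at_right (0::real)) (nhds x \<times>\<^sub>F at_right (0::real))"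
    by (rule filterlim_snd)
  hence s0: "((\<lambda>p. snd p) \<longlongrightarrow> 0) (nhds x \<times>\<^sub>F at_right (0::real))"
    by (simp add: filterlim_at)
  have "((\<lambda>p. fst p + snd p *\<^sub>R w) \<longlongrightarrow> x + 0 *\<^sub>R w) (nhds x \<times>\<^sub>F at_right (0::real))"
    by (intro tendsto_intros f s0)
  thus ?thesis
    unfolding case_prod_unfold by (intro filterlim_Pair s) simp
qed

lemma clarke_dderiv_add_le:
  fixes j :: "'a::real_normed_vector \<Rightarrow> real"
  assumes j: "locally_lipschitz_on UNIV j"
  shows "clarke_dderiv j x (v + w) \<le> clarke_dderiv j x v + clarke_dderiv j x w"
proof (rule clarke_dderivI[OF j])
  fix b assume b: "b > clarke_dderiv j x v + clarke_dderiv j x w"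
  define e where "e = (b - clarke_dderiv j x v - clarke_dderiv j x w) / 2"
  have e: "e > 0" using b by (simp add: e_def)
  have "\<forall>\<^sub>F (y, l) in nhds x \<times>\<^sub>F at_right 0.
      (j (y + l *\<^sub>R v) - j y) / l < clarke_dderiv j x v + e"
    by (rule eventually_clarke_quotient_less[OF j]) (use e in simp)
  from eventually_compose_filterlim[OF this filterlim_translate_ray[of w]]
  have 1: "\<forall>\<^sub>F (y, l) in nhds x \<times>\<^sub>F at_right 0.
      (j (y + l *\<^sub>R w + l *\<^sub>R v) - j (y + l *\<^sub>R w)) / l < clarke_dderiv j x v + e"
    by (simp add: case_prod_unfold)
  have 2: "\<forall>\<^sub>F (y, l) in nhds x \<times>\<^sub>F at_right 0.
      (j (y + l *\<^sub>R w) - j y) / l < clarke_dderiv j x w + e"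
    by (rule eventually_clarke_quotient_less[OF j]) (use e in simp)
  show "\<forall>\<^sub>F (y, l) in nhds x \<times>\<^sub>F at_right 0. (j (y + l *\<^sub>R (v + w)) - j y) / l < b"
    using 1 2
  proof eventually_elim
    case (elim p)
    obtain y l where p: "p = (y, l)" by (cases p)
    have "(j (y + l *\<^sub>R (v + w)) - j y) / l =
        (j (y + l *\<^sub>R w + l *\<^sub>R v) - j (y + l *\<^sub>R w)) / l + (j (y + l *\<^sub>R w) - j y) / l"
      by (simp add: algebra_simps flip: add_divide_distrib)
    also have "\<dots> < (clarke_dderiv j x v + e) + (clarke_dderiv j x w + e)"
      using elim unfolding p prod.case by (rule add_strict_mono)
    also have "\<dots> = b" by (simp add: e_def field_simps)
    finally show ?case by (simp add: p)
  qed
qed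

lemma clarke_dderiv_scaleR_le:
  fixes j :: "'a::real_normed_vector \<Rightarrow> real"
  assumes j: "locally_lipschitz_on UNIV j" and a: "a > 0"
  shows "clarke_dderiv j x (a *\<^sub>R v) \<le> a * clarke_dderiv j x v"
proof (rule clarke_dderivI[OF j])
  fix b assume b: "b > a * clarke_dderiv j x v"
  have "\<forall>\<^sub>F (y, l) in nhds x \<times>\<^sub>F at_right 0. (j (y + l *\<^sub>R v) - j y) / l < b / a"
    by (rule eventually_clarke_quotient_less[OF j]) (use a b in \<open>simp add: field_simps\<close>)
  moreover have "filterlim (\<lambda>p. a * snd p) (at_right 0) (nhds x \<times>\<^sub>F at_right (0::real))"
  proof -
    have s: "filterlim snd (at_right (0::real)) (nhds x \<times>\<^sub>F at_right (0::real))"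
      by (rule filterlim_snd)
    hence "((\<lambda>p. a * snd p) \<longlongrightarrow> a * 0) (nhds x \<times>\<^sub>F at_right (0::real))"
      by (intro tendsto_intros) (simp add: filterlim_at)
    moreover have "eventually (\<lambda>p. snd p > (0::real)) (nhds x \<times>\<^sub>F at_right (0::real))"
      by (rule eventually_compose_filterlim[OF eventually_at_right_less filterlim_snd])
    ultimately show ?thesis
      unfolding filterlim_at using a by (auto elim: eventually_mono)
  qed
  hence "filterlim (\<lambda>(y, l). (y, a * l)) (nhds x \<times>\<^sub>F at_right 0) (nhds x \<times>\<^sub>F at_right (0::real))"
    unfolding case_prod_unfold by (intro filterlim_Pair filterlim_fst)
  ultimately have "\<forall>\<^sub>F (y, l) in nhds x \<times>\<^sub>F at_right 0.
      (j (y + (a * l) *\<^sub>R v) - j y) / (a * l) < b / a"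
    using eventually_compose_filterlim by (fastforce simp: case_prod_unfold)
  thus "\<forall>\<^sub>F (y, l) in nhds x \<times>\<^sub>F at_right 0. (j (y + l *\<^sub>R (a *\<^sub>R v)) - j y) / l < b"
  proof (rule eventually_mono)
    fix p :: "'a \<times> real"
    obtain y l where p: "p = (y, l)" by (cases p)
    show "case p of (y, l) \<Rightarrow> (j (y + (a * l) *\<^sub>R v) - j y) / (a * l) < b / a \<Longrightarrow>
        case p of (y, l) \<Rightarrow> (j (y + l *\<^sub>R a *\<^sub>R v) - j y) / l < b"
      using a by (simp add: p mult.commute[of l a] pos_less_divide_eq)
  qed
qed

lemma sublinear_clarke_dderiv:
  fixes j :: "'a::real_normed_vector \<Rightarrow> real"
  assumes "locally_lipschitz_on UNIV j"
  shows "sublinear (clarke_dderiv j x)"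
  using clarke_dderiv_add_le[OF assms] clarke_dderiv_scaleR_le[OF assms] by (simp add: sublinear_def)

lemma clarke_dderiv_le_lipschitz:
  fixes j :: "'a::real_normed_vector \<Rightarrow> real"
  assumes j: "locally_lipschitz_on UNIV j"
  shows "\<exists>L. \<forall>v. clarke_dderiv j x v \<le> L * norm v"
proof -
  obtain e L where e: "e > 0" and L: "L-lipschitz_on (ball x e) j"
    using j[unfolded locally_lipschitz_on_def, rule_format, of x] by auto
  have "clarke_dderiv j x v \<le> L * norm v" for v
  proof (rule clarke_dderivI[OF j])
    fix b assume b: "b > L * norm v"
    have ball: "\<forall>\<^sub>F y in nhds x. y \<in> ball x e"
      by (rule eventually_nhds_in_open) (use e in auto)
    have 1: "\<forall>\<^sub>F p in nhds x \<times>\<^sub>F at_right (0::real). fst p \<in> ball x e"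
      using eventually_compose_filterlim[OF ball filterlim_fst] .
    have "filterlim (\<lambda>(y, l). y + l *\<^sub>R v) (nhds x) (nhds x \<times>\<^sub>F at_right 0)"
      using filterlim_compose[OF filterlim_fst filterlim_translate_ray[of v x]]
      by (simp add: case_prod_unfold)
    from eventually_compose_filterlim[OF ball this]
    have 2: "\<forall>\<^sub>F (y, l) in nhds x \<times>\<^sub>F at_right 0. y + l *\<^sub>R v \<in> ball x e"
      by (simp add: case_prod_unfold)
    have 3: "\<forall>\<^sub>F p in nhds x \<times>\<^sub>F at_right 0. snd p > (0::real)"
      by (rule eventually_compose_filterlim[OF eventually_at_right_less filterlim_snd])
    show "\<forall>\<^sub>F (y, l) in nhds x \<times>\<^sub>F at_right 0. (j (y + l *\<^sub>R v) - j y) / l < b"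
      using 1 2 3
    proof eventually_elim
      case (elim p)
      obtain y l where p: "p = (y, l)" by (cases p)
      have l: "l > 0" using elim p by simp
      have "j (y + l *\<^sub>R v) - j y \<le> L * (l * norm v)"
        using lipschitz_onD[OF L, of "y + l *\<^sub>R v" y] elim l by (simp add: dist_norm p)
      hence "(j (y + l *\<^sub>R v) - j y) / l \<le> L * norm v"
        using l by (simp add: field_simps)
      thus ?case using b by (simp add: p)
    qed
  qed
  thus ?thesis by blast
qed

text \<open>\<open>j\<^sup>0(x; v)\<close> is the maximum, not only an upper bound, of \<open>\<langle>\<xi>, v\<rangle>\<close> over the subdifferential. The
  supporting functional is bounded because the local Lipschitz constant bounds \<open>j\<^sup>0(x; v)\<close> and
  \<open>j\<^sup>0(x; - v)\<close>.\<close>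

lemma clarke_subdiff_attains_dderiv:
  fixes j :: "'a::real_normed_vector \<Rightarrow> real"
  assumes j: "locally_lipschitz_on UNIV j"
  shows "\<exists>\<xi>\<in>clarke_subdiff j x. blinfun_apply \<xi> v = clarke_dderiv j x v"
proof -
  obtain \<xi> where \<xi>: "linear \<xi>" "\<xi> \<le> clarke_dderiv j x" "\<xi> v = clarke_dderiv j x v"
    using sublinear_supporting_functional[OF sublinear_clarke_dderiv[OF j]] by blast
  obtain L where L: "\<And>v. clarke_dderiv j x v \<le> L * norm v"
    using clarke_dderiv_le_lipschitz[OF j] by blast
  have le: "\<xi> w \<le> L * norm w" for w
    using le_funD[OF \<xi>(2), of w] L[of w] by linarith
  have "\<bar>\<xi> w\<bar> \<le> L * norm w" for w
    using le[of w] le[of "- w"] linear_neg[OF \<xi>(1), of w] by simp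
  hence "bounded_linear \<xi>"
    using \<xi>(1) by (intro bounded_linear_intro[where K = L])
      (auto simp: linear_add linear_scale mult.commute)
  hence eq: "blinfun_apply (Blinfun \<xi>) = \<xi>"
    by (rule bounded_linear_Blinfun_apply)
  show ?thesis
    using \<xi>(2,3) by (intro bexI[of _ "Blinfun \<xi>"]) (auto simp: clarke_subdiff_def eq dest: le_funD)
qed

text \<open>This turns a growth condition on the subdifferential into an estimate of the generalized
  derivative.\<close>

lemma clarke_dderiv_le_subdiff_bound:
  fixes j :: "'a::real_normed_vector \<Rightarrow> real"
  assumes "locally_lipschitz_on UNIV j" "\<And>\<xi>. \<xi> \<in> clarke_subdiff j x \<Longrightarrow> norm \<xi> \<le> C"
  shows "clarke_dderiv j x v \<le> C * norm v"
proof -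
  obtain \<xi> where \<xi>: "\<xi> \<in> clarke_subdiff j x" "blinfun_apply \<xi> v = clarke_dderiv j x v"
    using clarke_subdiff_attains_dderiv[OF assms(1)] by blast
  have "clarke_dderiv j x v \<le> norm \<xi> * norm v"
    using norm_blinfun[of \<xi> v] \<xi>(2) by simp
  also have "\<dots> \<le> C * norm v"
    using assms(2)[OF \<xi>(1)] by (rule mult_right_mono) simp
  finally show ?thesis .
qed

text \<open>Without this regularity the upper limit defining the generalized derivative of the energy could
  be infinite, and its conversion to a real number meaningless.\<close>

lemma locally_lipschitz_on_energy:
  fixes A :: "'v::real_normed_vector \<Rightarrow> 'v \<Rightarrow>\<^sub>L real" and \<gamma> :: "'v \<Rightarrow>\<^sub>L 'x::real_normed_vector"
  assumes A: "bounded_linear A" and g: "locally_lipschitz_on UNIV g"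
  shows "locally_lipschitz_on S (\<lambda>w. 1 / 2 * blinfun_apply (A w) w + blinfun_apply l w
    + g (blinfun_apply \<gamma> w))"
  unfolding locally_lipschitz_on_def
proof
  fix x :: 'v
  obtain a where a: "a \<ge> 0" "\<And>w. norm (A w) \<le> norm w * a"
    using bounded_linear.nonneg_bounded[OF A] by blast
  obtain e L where e: "e > 0" and L: "L-lipschitz_on (ball (blinfun_apply \<gamma> x) e) g"
    using g[unfolded locally_lipschitz_on_def, rule_format, of "blinfun_apply \<gamma> x"] by auto
  have "open (blinfun_apply \<gamma> -` ball (blinfun_apply \<gamma> x) e)"
    by (intro open_vimage continuous_intros open_ball)
  moreover have "x \<in> blinfun_apply \<gamma> -` ball (blinfun_apply \<gamma> x) e" using e by simp
  ultimately obtain d0 where d0: "d0 > 0" "ball x d0 \<subseteq> blinfun_apply \<gamma> -` ball (blinfun_apply \<gamma> x) e"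
    unfolding open_contains_ball by blast
  define d where "d = min d0 1"
  define R where "R = norm x + 1"
  have d: "d > 0" using d0 by (simp add: d_def)
  have R: "norm y \<le> R" if "y \<in> ball x d" for y
    using that norm_triangle_ineq2[of y x] by (simp add: R_def d_def dist_norm norm_minus_commute)
  have quad: "(a * R)-lipschitz_on (ball x d) (\<lambda>w. 1 / 2 * blinfun_apply (A w) w)"
  proof (rule lipschitz_onI)
    fix y z assume y: "y \<in> ball x d" and z: "z \<in> ball x d"
    have "A y y - A z z = A (y - z) y + A z (y - z)"
      by (simp add: bounded_linear.linear[OF A, THEN linear_diff] blinfun.diff_left blinfun.diff_right)
    also have "\<bar>\<dots>\<bar> \<le> \<bar>A (y - z) y\<bar> + \<bar>A z (y - z)\<bar>" by simp
    also have "\<dots> \<le> norm (A (y - z)) * norm y + norm (A z) * norm (y - z)"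
      using norm_blinfun[of "A (y - z)" y] norm_blinfun[of "A z" "y - z"] by simp
    also have "\<dots> \<le> (norm (y - z) * a) * R + (R * a) * norm (y - z)"
      using a R[OF y] R[OF z] mult_right_mono[OF R[OF z] a(1)] order_trans[OF norm_ge_zero R[OF z]]
      by (intro add_mono mult_mono) (auto intro: order_trans)
    finally show "dist (1 / 2 * blinfun_apply (A y) y) (1 / 2 * blinfun_apply (A z) z) \<le> a * R * dist y z"
      by (simp add: dist_norm algebra_simps flip: right_diff_distrib)
  next
    show "0 \<le> a * R" using a by (simp add: R_def)
  qed
  have lin: "(norm l)-lipschitz_on (ball x d) (blinfun_apply l)"
    using norm_blinfun[of l] by (intro lipschitz_onI) (auto simp: dist_norm simp flip: blinfun.diff_right)
  have "(norm \<gamma>)-lipschitz_on (ball x d) (blinfun_apply \<gamma>)"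
    using norm_blinfun[of \<gamma>] by (intro lipschitz_onI) (auto simp: dist_norm simp flip: blinfun.diff_right)
  moreover have "L-lipschitz_on (blinfun_apply \<gamma> ` ball x d) g"
    using d0 by (intro lipschitz_on_subset[OF L]) (auto simp: d_def)
  ultimately have comp: "(L * norm \<gamma>)-lipschitz_on (ball x d) (\<lambda>w. g (blinfun_apply \<gamma> w))"
    by (rule lipschitz_on_compose2)
  have "(a * R + norm l + L * norm \<gamma>)-lipschitz_on (ball x d)
      (\<lambda>w. 1 / 2 * blinfun_apply (A w) w + blinfun_apply l w + g (blinfun_apply \<gamma> w))"
    by (intro lipschitz_on_add quad lin comp)
  thus "\<exists>e>0. \<exists>L. L-lipschitz_on (ball x e \<inter> S)
      (\<lambda>w. 1 / 2 * blinfun_apply (A w) w + blinfun_apply l w + g (blinfun_apply \<gamma> w))"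
    using d by (blast intro: lipschitz_on_subset)
qed

text \<open>The discrete problem is stated with the subdifferential of the energy on the subspace. Its
  quadratic and linear parts are continuously differentiable and contribute their derivative; the chain
  rule for \<open>g \<circ> \<gamma>\<close> is an inequality because the base points \<open>\<gamma> y\<close> with \<open>y\<close> in the subspace form only a
  part of the base points near \<open>\<gamma> u\<close>. Symmetry of \<open>A\<close> makes the derivative of \<open>A w w / 2\<close> equal to
  \<open>A u\<close>.\<close>

lemma clarke_dderiv_on_energy_le:
  fixes A :: "'v::real_normed_vector \<Rightarrow> 'v \<Rightarrow>\<^sub>L real" and \<gamma> :: "'v \<Rightarrow>\<^sub>L 'x::real_normed_vector"
  assumes A: "bounded_linear A" and sym: "\<And>u w. blinfun_apply (A u) w = blinfun_apply (A w) u"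
    and g: "locally_lipschitz_on UNIV g" and S: "subspace S" "u \<in> S" "w \<in> S"
  shows "clarke_dderiv_on S (\<lambda>w. 1 / 2 * blinfun_apply (A w) w + blinfun_apply l w
      + g (blinfun_apply \<gamma> w)) u w
    \<le> blinfun_apply (A u) w + blinfun_apply l w
      + clarke_dderiv g (blinfun_apply \<gamma> u) (blinfun_apply \<gamma> w)" (is "_ \<le> ?a + ?g")
  unfolding clarke_dderiv_on_le_iff[OF locally_lipschitz_on_energy[OF A g] S]
proof (intro allI impI)
  fix b assume b: "b > ?a + ?g"
  define e where "e = (b - ?a - ?g) / 2"
  have e: "e > 0" using b by (simp add: e_def)
  let ?F = "inf (nhds u) (principal S) \<times>\<^sub>F at_right (0::real)"
  have f: "(fst \<longlongrightarrow> u) ?F"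
    by (rule filterlim_mono[OF filterlim_fst inf_le1 order_refl])
  have s: "filterlim snd (at_right (0::real)) ?F"
    by (rule filterlim_snd)
  have s0: "(snd \<longlongrightarrow> 0) ?F" and pos: "\<forall>\<^sub>F p in ?F. snd p > 0"
    using s by (auto simp: filterlim_at elim: eventually_mono)
  have "((\<lambda>p. A (fst p)) \<longlongrightarrow> A u) ?F"
    by (rule bounded_linear.tendsto[OF A f])
  hence "((\<lambda>p. A (fst p) w + snd p * (1 / 2 * A w w) + l w) \<longlongrightarrow> A u w + 0 * (1 / 2 * A w w) + l w) ?F"
    by (intro tendsto_intros s0)
  hence 1: "\<forall>\<^sub>F p in ?F. A (fst p) w + snd p * (1 / 2 * A w w) + l w < ?a + e"
    by (rule order_tendstoD) (use e in simp)
  have "((\<lambda>p. blinfun_apply \<gamma> (fst p)) \<longlongrightarrow> \<gamma> u) ?F"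
    by (intro tendsto_intros f)
  hence "filterlim (\<lambda>p. (blinfun_apply \<gamma> (fst p), snd p)) (nhds (\<gamma> u) \<times>\<^sub>F at_right 0) ?F"
    by (intro filterlim_Pair s)
  from eventually_compose_filterlim[OF eventually_clarke_quotient_less[OF g, of "\<gamma> u" "\<gamma> w" "?g + e"] this]
  have 2: "\<forall>\<^sub>F p in ?F. (g (\<gamma> (fst p) + snd p *\<^sub>R \<gamma> w) - g (\<gamma> (fst p))) / snd p < ?g + e"
    using e by simp
  show "\<forall>\<^sub>F (y, r) in ?F. (1 / 2 * A (y + r *\<^sub>R w) (y + r *\<^sub>R w) + l (y + r *\<^sub>R w) + g (\<gamma> (y + r *\<^sub>R w))
      - (1 / 2 * A y y + l y + g (\<gamma> y))) / r < b"
    using 1 2 pos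
  proof eventually_elim
    case (elim p)
    obtain y r where p: "p = (y, r)" by (cases p)
    have r: "r > 0" using elim p by simp
    have "A (y + r *\<^sub>R w) (y + r *\<^sub>R w) = A y y + 2 * r * A y w + r * r * A w w"
      using sym[of w y]
      by (simp add: bounded_linear.linear[OF A, THEN linear_add] bounded_linear.linear[OF A, THEN linear_scale]
        blinfun.add_left blinfun.add_right blinfun.scaleR_left blinfun.scaleR_right algebra_simps)
    hence "(1 / 2 * A (y + r *\<^sub>R w) (y + r *\<^sub>R w) + l (y + r *\<^sub>R w) + g (\<gamma> (y + r *\<^sub>R w))
        - (1 / 2 * A y y + l y + g (\<gamma> y))) / r
      = (A y w + r * (1 / 2 * A w w) + l w) + (g (\<gamma> y + r *\<^sub>R \<gamma> w) - g (\<gamma> y)) / r"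
      using r by (simp add: blinfun.add_right blinfun.scaleR_right field_simps)
    also have "\<dots> < (?a + e) + (?g + e)"
      using elim unfolding p fst_conv snd_conv by (intro add_strict_mono[of "_ + _ + _"])
    also have "\<dots> = b" by (simp add: e_def field_simps)
    finally show ?case by (simp add: p)
  qed
qed

section \<open>A smooth step function\<close>

text \<open>Test functions are differentiable up to every order. Counting the orders makes
  closure under the algebraic operations provable by induction, since the derivative of a product or an
  inverse is again built from such operations and has one order less.\<close>

definition differentiable_upto :: "nat \<Rightarrow> (real \<Rightarrow> real) \<Rightarrow> bool" where
  "differentiable_upto n \<phi> \<longleftrightarrow> (\<forall>m\<le>n. \<forall>t. (deriv ^^ m) \<phi> differentiable (at t))"

lemma differentiable_upto_0: "differentiable_upto 0 \<phi> \<longleftrightarrow> (\<forall>t. \<phi> differentiable (at t))"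
  by (simp add: differentiable_upto_def)

lemma differentiable_upto_Suc:
  "differentiable_upto (Suc n) \<phi> \<longleftrightarrow>
    (\<forall>t. \<phi> differentiable (at t)) \<and> differentiable_upto n (deriv \<phi>)"
proof -
  have "(\<forall>m\<le>Suc n. P m) \<longleftrightarrow> P 0 \<and> (\<forall>m\<le>n. P (Suc m))" for P :: "nat \<Rightarrow> bool"
    by (metis Suc_le_mono not0_implies_Suc zero_le)
  thus ?thesis
    unfolding differentiable_upto_def by (simp add: funpow_Suc_right del: funpow.simps)
qed

lemma differentiable_upto_imp_differentiable:
  "differentiable_upto n \<phi> \<Longrightarrow> \<phi> differentiable (at t)"
  by (cases n) (auto simp: differentiable_upto_0 differentiable_upto_Suc)

lemma differentiable_upto_SucD: "differentiable_upto (Suc n) \<phi> \<Longrightarrow> differentiable_upto n \<phi>"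
  by (simp add: differentiable_upto_def)

lemma differentiable_upto_SucI:
  assumes "\<And>t. (\<phi> has_real_derivative \<psi> t) (at t)" "differentiable_upto n \<psi>"
  shows "differentiable_upto (Suc n) \<phi>"
proof -
  have "deriv \<phi> = \<psi>" using DERIV_imp_deriv[OF assms(1)] by blast
  thus ?thesis
    using assms by (auto simp: differentiable_upto_Suc real_differentiable_def)
qed

lemma differentiable_upto_has_deriv:
  "differentiable_upto n \<phi> \<Longrightarrow> (\<phi> has_real_derivative deriv \<phi> t) (at t)"
  by (simp add: DERIV_deriv_iff_real_differentiable differentiable_upto_imp_differentiable)

lemma differentiable_upto_const: "differentiable_upto n (\<lambda>_. c)"
proof (induction n arbitrary: c)
  case 0 show ?case by (simp add: differentiable_upto_0)
next
  case (Suc n)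
  show ?case by (rule differentiable_upto_SucI[where \<psi> = "\<lambda>_. 0"]) (auto intro: Suc)
qed

lemma differentiable_upto_add:
  "differentiable_upto n f \<Longrightarrow> differentiable_upto n g \<Longrightarrow> differentiable_upto n (\<lambda>t. f t + g t)"
proof (induction n arbitrary: f g)
  case 0 thus ?case by (simp add: differentiable_upto_0)
next
  case (Suc n)
  note d = differentiable_upto_has_deriv[OF Suc.prems(1)] differentiable_upto_has_deriv[OF Suc.prems(2)]
  have "differentiable_upto n (\<lambda>t. deriv f t + deriv g t)"
    using Suc.prems by (intro Suc.IH) (auto simp: differentiable_upto_Suc)
  thus ?case by (rule differentiable_upto_SucI[rotated]) (intro DERIV_add d)
qed

lemma differentiable_upto_mult:
  "differentiable_upto n f \<Longrightarrow> differentiable_upto n g \<Longrightarrow> differentiable_upto n (\<lambda>t. f t * g t)"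
proof (induction n arbitrary: f g)
  case 0 thus ?case by (simp add: differentiable_upto_0)
next
  case (Suc n)
  note d = differentiable_upto_has_deriv[OF Suc.prems(1)] differentiable_upto_has_deriv[OF Suc.prems(2)]
  have "differentiable_upto n (\<lambda>t. deriv f t * g t + deriv g t * f t)"
    using Suc.prems Suc.prems[THEN differentiable_upto_SucD]
    by (intro differentiable_upto_add Suc.IH) (auto simp: differentiable_upto_Suc)
  thus ?case by (rule differentiable_upto_SucI[rotated]) (intro DERIV_mult d)
qed

lemma differentiable_upto_inverse:
  "differentiable_upto n f \<Longrightarrow> (\<And>t. f t \<noteq> 0) \<Longrightarrow> differentiable_upto n (\<lambda>t. inverse (f t))"
proof (induction n)
  case 0 thus ?case by (simp add: differentiable_upto_0)
next
  case (Suc n)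
  note d = differentiable_upto_has_deriv[OF Suc.prems(1)]
  have i: "differentiable_upto n (\<lambda>t. inverse (f t))"
    using Suc by (blast dest: differentiable_upto_SucD)
  have "differentiable_upto n (\<lambda>t. - 1 * (inverse (f t) * deriv f t * inverse (f t)))"
    using Suc.prems by (intro differentiable_upto_mult differentiable_upto_const i)
      (auto simp: differentiable_upto_Suc)
  thus ?case
    by (rule differentiable_upto_SucI[rotated])
      (use DERIV_inverse'[OF d] Suc.prems(2) in simp)
qed

lemma differentiable_upto_affine:
  "differentiable_upto n f \<Longrightarrow> differentiable_upto n (\<lambda>t. f (a * t + b))"
proof (induction n arbitrary: f)
  case 0
  have "((\<lambda>t. f (a * t + b)) has_real_derivative deriv f (a * t + b) * a) (at t)" for t
    by (rule DERIV_chain2[OF differentiable_upto_has_deriv[OF 0]]) (auto intro!: derivative_eq_intros)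
  thus ?case by (auto simp: differentiable_upto_0 real_differentiable_def)
next
  case (Suc n)
  have "((\<lambda>t. f (a * t + b)) has_real_derivative deriv f (a * t + b) * a) (at t)" for t
    by (rule DERIV_chain2[OF differentiable_upto_has_deriv[OF Suc.prems]])
      (auto intro!: derivative_eq_intros)
  moreover have "differentiable_upto n (\<lambda>t. deriv f (a * t + b) * a)"
    using Suc.prems by (intro differentiable_upto_mult differentiable_upto_const Suc.IH)
      (auto simp: differentiable_upto_Suc)
  ultimately show ?case by (rule differentiable_upto_SucI)
qed

text \<open>The functions \<open>p(1/x) e\<^bsup>-1/x\<^esup>\<close>, extended by \<open>0\<close>. The family contains the classical flat function
  \<open>e\<^bsup>-1/x\<^esup>\<close> (for \<open>p = 1\<close>), and the polynomial is there to make it closed under differentiation.\<close>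

definition flat_exp :: "real poly \<Rightarrow> real \<Rightarrow> real" where
  "flat_exp p x = (if x > 0 then poly p (inverse x) * exp (- inverse x) else 0)"

lemma poly_exp_neg_tendsto_0: "((\<lambda>x. poly p x * exp (- x)) \<longlongrightarrow> 0) at_top" for p :: "real poly"
proof -
  have "((\<lambda>x. \<Sum>i\<le>degree p. coeff p i * (x ^ i / exp x)) \<longlongrightarrow> (\<Sum>i\<le>degree p. coeff p i * 0)) at_top"
    by (intro tendsto_intros tendsto_power_div_exp_0)
  thus ?thesis
    by (simp add: poly_altdef sum_distrib_right exp_minus divide_inverse mult.assoc)
qed

text \<open>The chain rule gives \<open>(p(y) - p'(y)) y\<^sup>2 e\<^bsup>-y\<^esup>\<close> at \<open>y = 1/x\<close>. At the origin the quotient from the right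
  is \<open>p(y) y e\<^bsup>-y\<^esup>\<close>, which vanishes as \<open>y \<rightarrow> \<infinity>\<close>.\<close>

lemma DERIV_flat_exp:
  "(flat_exp p has_real_derivative flat_exp ((p - pderiv p) * [:0, 0, 1:]) x) (at x)"
proof -
  consider "x > 0" | "x < 0" | "x = 0" by linarith
  thus ?thesis
  proof cases
    case 1
    have "((\<lambda>x. poly p (inverse x) * exp (- inverse x)) has_real_derivative
        flat_exp ((p - pderiv p) * [:0, 0, 1:]) x) (at x)"
      using 1 by (auto intro!: derivative_eq_intros DERIV_chain2[OF poly_DERIV]
        simp: flat_exp_def algebra_simps power2_eq_square)
    moreover have "\<forall>\<^sub>F y in nhds x. flat_exp p y = poly p (inverse y) * exp (- inverse y)"
      using eventually_nhds_in_open[of "{0<..}" x] 1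
      by (auto simp: flat_exp_def elim!: eventually_mono)
    ultimately show ?thesis by (simp add: DERIV_cong_ev[OF refl _ refl])
  next
    case 2
    have "\<forall>\<^sub>F y in nhds x. flat_exp p y = 0"
      using eventually_nhds_in_open[of "{..<0}" x] 2
      by (auto simp: flat_exp_def elim!: eventually_mono)
    thus ?thesis using 2 by (simp add: DERIV_cong_ev[OF refl _ refl] flat_exp_def)
  next
    case 3
    have "((\<lambda>y. poly (p * [:0, 1:]) (inverse y) * exp (- inverse y)) \<longlongrightarrow> 0) (at_right 0)"
      by (rule filterlim_compose[OF poly_exp_neg_tendsto_0 filterlim_inverse_at_top_right])
    hence "((\<lambda>y. (flat_exp p y - flat_exp p 0) / (y - 0)) \<longlongrightarrow> 0) (at_right 0)"
      by (rule filterlim_cong[THEN iffD1, OF refl refl, rotated])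
        (auto simp: eventually_at_filter flat_exp_def field_simps)
    moreover have "((\<lambda>y. (flat_exp p y - flat_exp p 0) / (y - 0)) \<longlongrightarrow> 0) (at_left 0)"
      by (rule tendsto_eventually) (auto simp: eventually_at_filter flat_exp_def)
    ultimately have "((\<lambda>y. (flat_exp p y - flat_exp p 0) / (y - 0)) \<longlongrightarrow> 0) (at 0)"
      by (simp add: filterlim_split_at)
    thus ?thesis unfolding 3 has_field_derivative_iff by (simp add: flat_exp_def)
  qed
qed

lemma differentiable_upto_flat_exp: "differentiable_upto n (flat_exp p)"
proof (induction n arbitrary: p)
  case 0
  show ?case using DERIV_flat_exp by (auto simp: differentiable_upto_0 real_differentiable_def)
next
  case (Suc n)
  show ?case by (rule differentiable_upto_SucI[OF DERIV_flat_exp Suc])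
qed

definition smooth_step :: "real \<Rightarrow> real" where
  "smooth_step x = flat_exp 1 x * inverse (flat_exp 1 x + flat_exp 1 (1 - x))"

lemma flat_exp_nonneg: "flat_exp 1 x \<ge> 0"
  by (simp add: flat_exp_def)

lemma smooth_step_denominator_pos: "flat_exp 1 x + flat_exp 1 (1 - x) > 0"
  using flat_exp_nonneg[of x] flat_exp_nonneg[of "1 - x"]
  by (cases "x > 0") (auto simp: flat_exp_def intro: add_pos_nonneg)

lemma differentiable_upto_smooth_step: "differentiable_upto n smooth_step"
proof -
  have "differentiable_upto n (\<lambda>x. flat_exp 1 (- 1 * x + 1))"
    by (intro differentiable_upto_affine differentiable_upto_flat_exp)
  hence "differentiable_upto n (\<lambda>x. flat_exp 1 (1 - x))" by simp
  hence "differentiable_upto n (\<lambda>x. flat_exp 1 x * inverse (flat_exp 1 x + flat_exp 1 (1 - x)))"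
    using smooth_step_denominator_pos
    by (intro differentiable_upto_mult differentiable_upto_inverse differentiable_upto_add
      differentiable_upto_flat_exp) (auto simp: less_le)
  thus ?thesis by (simp add: smooth_step_def[abs_def])
qed

lemma smooth_step_eq_0: "x \<le> 0 \<Longrightarrow> smooth_step x = 0"
  by (simp add: smooth_step_def flat_exp_def)

lemma smooth_step_eq_1: "x \<ge> 1 \<Longrightarrow> smooth_step x = 1"
  by (simp add: smooth_step_def flat_exp_def)

lemma smooth_step_bounds: "0 \<le> smooth_step x" "smooth_step x \<le> 1"
  using flat_exp_nonneg[of x] flat_exp_nonneg[of "1 - x"] smooth_step_denominator_pos[of x]
  by (auto simp: smooth_step_def field_simps)

lemma DERIV_smooth_step: "(smooth_step has_real_derivative deriv smooth_step x) (at x)"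
  by (rule differentiable_upto_has_deriv[OF differentiable_upto_smooth_step])

lemma deriv_smooth_step_eq_0:
  assumes "x \<notin> {0..1}"
  shows "deriv smooth_step x = 0"
proof -
  have "\<forall>\<^sub>F y in nhds x. smooth_step y = (if x < 0 then 0 else 1)"
    using eventually_nhds_in_open[of "- {0..1}" x] eventually_nhds_in_open[of "{..<0}" x]
      eventually_nhds_in_open[of "{1<..}" x] assms
    by (cases "x < 0") (auto elim!: eventually_mono simp: smooth_step_eq_0 smooth_step_eq_1)
  hence "(smooth_step has_real_derivative 0) (at x)"
    using DERIV_cong_ev[OF refl, of smooth_step "\<lambda>_. if x < 0 then 0 else 1" x 0 0] by simp
  thus ?thesis by (rule DERIV_imp_deriv)
qed

lemma continuous_on_deriv_smooth_step: "continuous_on S (deriv smooth_step)"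
proof -
  have "differentiable_upto 0 (deriv smooth_step)"
    using differentiable_upto_smooth_step[of "Suc 0"] by (simp add: differentiable_upto_Suc)
  hence "isCont (deriv smooth_step) x" for x
    using differentiable_imp_continuous_within by (force simp: differentiable_upto_0)
  thus ?thesis by (simp add: continuous_at_imp_continuous_on)
qed

lemma deriv_smooth_step_bounded: "\<exists>K>0. \<forall>x. \<bar>deriv smooth_step x\<bar> \<le> K"
proof -
  have "compact (deriv smooth_step ` {0..1})"
    by (intro compact_continuous_image continuous_on_deriv_smooth_step compact_Icc)
  then obtain K where "K > 0" "\<And>x. x \<in> {0..1} \<Longrightarrow> norm (deriv smooth_step x) \<le> K"
    unfolding bounded_pos using compact_imp_bounded bounded_pos by (metis imageI)
  thus ?thesis using deriv_smooth_step_eq_0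
    by (intro exI[of _ K]) (metis abs_zero less_imp_le real_norm_def)
qed

section \<open>Lipschitz continuity of functions with bounded weak derivative\<close>

lemma DERIV_smooth_step_affine:
  assumes "\<epsilon> > 0"
  shows "((\<lambda>x. smooth_step ((x - a) / \<epsilon>)) has_real_derivative deriv smooth_step ((x - a) / \<epsilon>) / \<epsilon>) (at x)"
proof -
  have "((\<lambda>x. (x - a) / \<epsilon>) has_real_derivative 1 / \<epsilon>) (at x)"
    using assms by (auto intro!: derivative_eq_intros)
  from DERIV_chain2[OF DERIV_smooth_step this] show ?thesis by simp
qed

text \<open>A smooth approximation of the indicator function of \<open>[s, t]\<close>. Its derivative approximates the
  difference of two Dirac masses, so testing a weak derivative with it recovers the increment of the
  function between \<open>s\<close> and \<open>t\<close>.\<close>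

definition smooth_plateau :: "real \<Rightarrow> real \<Rightarrow> real \<Rightarrow> real \<Rightarrow> real" where
  "smooth_plateau s t \<epsilon> x = smooth_step ((x - s) / \<epsilon>) - smooth_step ((x - t) / \<epsilon>)"

lemma smooth_plateau_eq_0:
  assumes "\<epsilon> > 0" "s \<le> t" "x \<notin> {s..t + \<epsilon>}"
  shows "smooth_plateau s t \<epsilon> x = 0"
proof (cases "x < s")
  case True
  thus ?thesis using assms by (simp add: smooth_plateau_def smooth_step_eq_0 divide_nonpos_pos)
next
  case False
  thus ?thesis using assms by (simp add: smooth_plateau_def smooth_step_eq_1 field_simps)
qed

lemma abs_smooth_plateau_le: "\<bar>smooth_plateau s t \<epsilon> x\<bar> \<le> 1"
  using smooth_step_bounds[of "(x - s) / \<epsilon>"] smooth_step_bounds[of "(x - t) / \<epsilon>"]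
  by (simp add: smooth_plateau_def abs_le_iff)

lemma deriv_smooth_plateau:
  assumes "\<epsilon> > 0"
  shows "deriv (smooth_plateau s t \<epsilon>) x =
    deriv smooth_step ((x - s) / \<epsilon>) / \<epsilon> - deriv smooth_step ((x - t) / \<epsilon>) / \<epsilon>"
  unfolding smooth_plateau_def[abs_def]
  by (intro DERIV_imp_deriv DERIV_diff DERIV_smooth_step_affine assms)

lemma test_function_smooth_plateau:
  assumes "a < s" "s \<le> t" "\<epsilon> > 0" "t + \<epsilon> < b"
  shows "test_function a b (smooth_plateau s t \<epsilon>)"
proof -
  have "differentiable_upto n (\<lambda>x. smooth_step (1 / \<epsilon> * x + (- s / \<epsilon>))
      + (- 1) * smooth_step (1 / \<epsilon> * x + (- t / \<epsilon>)))" for n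
    by (intro differentiable_upto_add differentiable_upto_mult differentiable_upto_const
      differentiable_upto_affine differentiable_upto_smooth_step)
  hence "differentiable_upto n (smooth_plateau s t \<epsilon>)" for n
    by (simp add: smooth_plateau_def[abs_def] diff_divide_distrib)
  moreover have "closure {x. smooth_plateau s t \<epsilon> x \<noteq> 0} \<subseteq> {s..t + \<epsilon>}"
    using smooth_plateau_eq_0[OF assms(3,2)] by (intro closure_minimal) (blast, simp)
  moreover have "compact (closure {x. smooth_plateau s t \<epsilon> x \<noteq> 0})"
    using bounded_subset[OF bounded_closed_interval \<open>closure _ \<subseteq> _\<close>] by (simp add: compact_eq_bounded_closed)
  ultimately show ?thesis
    using assms unfolding test_function_def differentiable_upto_def by force
qed

lemma has_integral_indicator_interval:
  fixes c :: real
  assumes "a \<le> b" "{a..b} \<subseteq> S"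
  shows "((\<lambda>x. if x \<in> {a..b} then c else 0) has_integral c * (b - a)) S"
  unfolding has_integral_restrict[OF assms(2)]
  using has_integral_const_real[of c a b] assms(1) by (simp add: mult.commute)

text \<open>The derivatives of the rescaled step have integral \<open>1\<close>, are concentrated on \<open>[a, a + \<epsilon>]\<close> and
  have \<open>L\<^sup>1\<close> norm at most \<open>K\<close>, so they form an approximate identity at \<open>a\<close>.\<close>

lemma deriv_smooth_step_approx_identity:
  fixes v :: "real \<Rightarrow> 'a::banach"
  assumes v: "continuous_on {0..T} v" and \<epsilon>: "\<epsilon> > 0" and a: "0 \<le> a" "a + \<epsilon> \<le> T"
    and K: "\<And>x. \<bar>deriv smooth_step x\<bar> \<le> K" and osc: "\<And>x. x \<in> {a..a + \<epsilon>} \<Longrightarrow> norm (v x - v a) \<le> \<delta>"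
  shows "norm (integral {0..T} (\<lambda>x. (deriv smooth_step ((x - a) / \<epsilon>) / \<epsilon>) *\<^sub>R v x) - v a) \<le> K * \<delta>"
    and "(\<lambda>x. (deriv smooth_step ((x - a) / \<epsilon>) / \<epsilon>) *\<^sub>R v x) integrable_on {0..T}"
proof -
  define k where "k x = deriv smooth_step ((x - a) / \<epsilon>) / \<epsilon>" for x
  have k_cont: "continuous_on {0..T} k"
  proof -
    have "continuous_on {0..T} (\<lambda>x. (x - a) / \<epsilon>)"
      using \<epsilon> by (intro continuous_intros) simp
    hence "continuous_on {0..T} (\<lambda>x. deriv smooth_step ((x - a) / \<epsilon>))"
      by (rule continuous_on_compose2[OF continuous_on_deriv_smooth_step[of UNIV]]) simp
    thus ?thesis
      unfolding k_def by (rule continuous_on_divide[OF _ continuous_on_const]) (use \<epsilon> in simp)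
  qed
  show int: "(\<lambda>x. (deriv smooth_step ((x - a) / \<epsilon>) / \<epsilon>) *\<^sub>R v x) integrable_on {0..T}"
    unfolding k_def[symmetric] by (intro integrable_continuous_real continuous_intros k_cont v)
  have "(k has_integral (smooth_step ((T - a) / \<epsilon>) - smooth_step ((0 - a) / \<epsilon>))) {0..T}"
  proof (rule fundamental_theorem_of_calculus)
    show "0 \<le> T" using a \<epsilon> by linarith
    show "((\<lambda>x. smooth_step ((x - a) / \<epsilon>)) has_vector_derivative k x) (at x within {0..T})" for x
      unfolding k_def has_real_derivative_iff_has_vector_derivative[symmetric]
      by (rule has_field_derivative_at_within[OF DERIV_smooth_step_affine[OF \<epsilon>]])
  qed
  hence "(k has_integral 1) {0..T}"
    using a \<epsilon> by (simp add: smooth_step_eq_0 smooth_step_eq_1)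
  from has_integral_scaleR_left[OF this, of "v a"]
  have "((\<lambda>x. k x *\<^sub>R v a) has_integral v a) {0..T}" by simp
  hence d: "((\<lambda>x. k x *\<^sub>R v x - k x *\<^sub>R v a) has_integral
      (integral {0..T} (\<lambda>x. k x *\<^sub>R v x) - v a)) {0..T}"
    by (intro has_integral_diff integrable_integral int[folded k_def])
  have g: "((\<lambda>x. if x \<in> {a..a + \<epsilon>} then K / \<epsilon> * \<delta> else 0) has_integral
      (K / \<epsilon> * \<delta>) * (a + \<epsilon> - a)) {0..T}"
    using a \<epsilon> by (intro has_integral_indicator_interval) auto
  have "norm (integral {0..T} (\<lambda>x. k x *\<^sub>R v x - k x *\<^sub>R v a))
      \<le> integral {0..T} (\<lambda>x. if x \<in> {a..a + \<epsilon>} then K / \<epsilon> * \<delta> else 0)"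
  proof (rule integral_norm_bound_integral)
    fix x assume "x \<in> {0..T}"
    show "norm (k x *\<^sub>R v x - k x *\<^sub>R v a) \<le> (if x \<in> {a..a + \<epsilon>} then K / \<epsilon> * \<delta> else 0)"
    proof (cases "x \<in> {a..a + \<epsilon>}")
      case True
      have "\<bar>k x\<bar> \<le> K / \<epsilon>"
        using K[of "(x - a) / \<epsilon>"] \<epsilon> by (simp add: k_def divide_right_mono)
      hence "\<bar>k x\<bar> * norm (v x - v a) \<le> K / \<epsilon> * \<delta>"
        using osc[OF True] by (intro mult_mono) auto
      thus ?thesis using True by (simp flip: scaleR_diff_right)
    next
      case False
      hence "(x - a) / \<epsilon> \<notin> {0..1}" using \<epsilon> by (auto simp: field_simps)
      hence "k x = 0" by (simp add: k_def deriv_smooth_step_eq_0)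
      thus ?thesis using False by auto
    qed
  qed (use d g in auto)
  thus "norm (integral {0..T} (\<lambda>x. (deriv smooth_step ((x - a) / \<epsilon>) / \<epsilon>) *\<^sub>R v x) - v a) \<le> K * \<delta>"
    using \<epsilon> unfolding integral_unique[OF d] integral_unique[OF g] by (simp add: k_def)
qed

text \<open>Tested with the plateau function, the weak derivative is integrated over an interval of length
  \<open>t + \<epsilon> - s\<close>, and \<open>v\<close> is evaluated approximately at \<open>s\<close> and \<open>t\<close>.\<close>

lemma weak_derivative_increment_bound:
  fixes v g :: "real \<Rightarrow> 'a::banach"
  assumes v: "continuous_on {0..T} v" and g: "weak_derivative_on 0 T v g"
    and C: "C \<ge> 0" "AE x in lebesgue_on {0<..<T}. norm (g x) \<le> C"
    and st: "0 < s" "s \<le> t" and \<epsilon>: "\<epsilon> > 0" "t + \<epsilon> < T"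
    and K: "\<And>x. \<bar>deriv smooth_step x\<bar> \<le> K"
    and osc: "\<And>x. x \<in> {s..s + \<epsilon>} \<Longrightarrow> norm (v x - v s) \<le> \<delta>" "\<And>x. x \<in> {t..t + \<epsilon>} \<Longrightarrow> norm (v x - v t) \<le> \<delta>"
  shows "norm (v s - v t) \<le> C * (t + \<epsilon> - s) + 2 * K * \<delta>"
proof -
  define \<phi> where "\<phi> = smooth_plateau s t \<epsilon>"
  have "test_function 0 T \<phi>"
    unfolding \<phi>_def using st \<epsilon> by (intro test_function_smooth_plateau) auto
  then obtain I where I: "((\<lambda>x. deriv \<phi> x *\<^sub>R v x) has_integral I) {0..T}"
      "((\<lambda>x. \<phi> x *\<^sub>R g x) has_integral - I) {0..T}"
    using g unfolding weak_derivative_on_def by blast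
  obtain N where N: "negligible N" "\<And>x. x \<in> {0<..<T} - N \<Longrightarrow> norm (g x) \<le> C"
  proof -
    have "AE x in lebesgue. x \<in> {0<..<T} \<longrightarrow> norm (g x) \<le> C"
      using C(2) by (simp add: AE_restrict_space_iff)
    then obtain N where "{x \<in> space lebesgue. \<not> (x \<in> {0<..<T} \<longrightarrow> norm (g x) \<le> C)} \<subseteq> N"
        "N \<in> null_sets lebesgue"
      by (auto elim!: AE_E simp: null_sets_def)
    thus ?thesis using that[of N] by (auto simp: negligible_iff_null_sets)
  qed
  \<comment> \<open>The norm estimate for integrals requires a pointwise bound, so the null set \<open>N\<close> is removed.\<close>
  define h where "h x = (if x \<in> N then 0 else \<phi> x *\<^sub>R g x)" for x
  have h: "(h has_integral - I) {0..T}"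
    by (rule has_integral_spike[OF N(1) _ I(2)]) (simp add: h_def)
  have b: "((\<lambda>x. if x \<in> {s..t + \<epsilon>} then C else 0) has_integral C * (t + \<epsilon> - s)) {0..T}"
    using st \<epsilon> by (intro has_integral_indicator_interval) auto
  have "norm (integral {0..T} h) \<le> integral {0..T} (\<lambda>x. if x \<in> {s..t + \<epsilon>} then C else 0)"
  proof (rule integral_norm_bound_integral)
    fix x assume "x \<in> {0..T}"
    show "norm (h x) \<le> (if x \<in> {s..t + \<epsilon>} then C else 0)"
    proof (cases "x \<in> {s..t + \<epsilon>} - N")
      case True
      have "\<bar>\<phi> x\<bar> * norm (g x) \<le> 1 * C"
        using True st \<epsilon> by (intro mult_mono N(2)) (auto simp: \<phi>_def abs_smooth_plateau_le)
      thus ?thesis using True by (simp add: h_def)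
    next
      case False
      thus ?thesis using C(1) smooth_plateau_eq_0[OF \<epsilon>(1) st(2), of x] by (auto simp: h_def \<phi>_def)
    qed
  qed (use h b in auto)
  hence bound: "norm I \<le> C * (t + \<epsilon> - s)"
    unfolding integral_unique[OF h] integral_unique[OF b] by simp
  define Q where "Q a = integral {0..T} (\<lambda>x. (deriv smooth_step ((x - a) / \<epsilon>) / \<epsilon>) *\<^sub>R v x)" for a
  have Qs: "norm (Q s - v s) \<le> K * \<delta>" and Qt: "norm (Q t - v t) \<le> K * \<delta>"
    unfolding Q_def using st \<epsilon> K osc by (auto intro!: deriv_smooth_step_approx_identity(1)[OF v])
  have "I = integral {0..T} (\<lambda>x. deriv \<phi> x *\<^sub>R v x)"
    using I(1) by (simp add: integral_unique)
  also have "\<dots> = Q s - Q t"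
    unfolding Q_def \<phi>_def deriv_smooth_plateau[OF \<epsilon>(1)] scaleR_diff_left
    using st \<epsilon> K osc by (intro integral_diff deriv_smooth_step_approx_identity(2)[OF v]) auto
  finally have eq: "v s - v t = I - (Q s - v s) + (Q t - v t)" by simp
  have "norm (v s - v t) \<le> norm I + norm (Q s - v s) + norm (Q t - v t)"
    unfolding eq
    using norm_triangle_ineq[of "I - (Q s - v s)" "Q t - v t"] norm_triangle_ineq4[of I "Q s - v s"]
    by linarith
  thus ?thesis using bound Qs Qt by simp
qed

text \<open>Letting \<open>\<epsilon> \<rightarrow> 0\<close> in the preceding estimate gives the Lipschitz bound in the open interval, because
  \<open>v\<close> is continuous at \<open>s\<close> and \<open>t\<close>; by continuity it extends to the end points.\<close>

lemma W1infty_imp_lipschitz: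
  fixes v :: "real \<Rightarrow> 'a::banach"
  assumes v: "continuous_on {0..T} v" and W: "W1infty 0 T v" and T: "T > 0"
  shows "\<exists>L. L-lipschitz_on {0..T} v"
proof -
  obtain g C0 where g: "weak_derivative_on 0 T v g" "AE x in lebesgue_on {0<..<T}. norm (g x) \<le> C0"
    using W by (auto simp: W1infty_def Linfty_on_def)
  define C where "C = max C0 0"
  have C: "C \<ge> 0" "AE x in lebesgue_on {0<..<T}. norm (g x) \<le> C"
    using g(2) by (auto simp: C_def elim: eventually_mono)
  obtain K where K: "K > 0" "\<And>x. \<bar>deriv smooth_step x\<bar> \<le> K"
    using deriv_smooth_step_bounded by blast
  have le: "norm (v s - v t) \<le> C * (t - s)" if st: "0 < s" "s \<le> t" "t < T" for s t
  proof (rule field_le_epsilon)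
    fix e :: real assume e: "e > 0"
    define \<delta> where "\<delta> = e / (4 * K)"
    have \<delta>: "\<delta> > 0" using e K by (simp add: \<delta>_def)
    have osc: "\<exists>d>0. \<forall>x\<in>{0..T}. dist x r < d \<longrightarrow> dist (v x) (v r) < \<delta>" if "r \<in> {0..T}" for r
      using v that \<delta> unfolding continuous_on_iff by blast
    obtain d1 where d1: "d1 > 0" "\<And>x. x \<in> {0..T} \<Longrightarrow> dist x s < d1 \<Longrightarrow> dist (v x) (v s) < \<delta>"
      using osc[of s] st by auto
    obtain d2 where d2: "d2 > 0" "\<And>x. x \<in> {0..T} \<Longrightarrow> dist x t < d2 \<Longrightarrow> dist (v x) (v t) < \<delta>"
      using osc[of t] st by auto
    have "0 < min (min d1 d2) (min (T - t) (e / (2 * (C + 1))))"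
      using d1(1) d2(1) st(3) e C by simp
    from dense[OF this] obtain \<epsilon>
      where "0 < \<epsilon>" "\<epsilon> < min (min d1 d2) (min (T - t) (e / (2 * (C + 1))))" by blast
    hence \<epsilon>: "\<epsilon> > 0" "\<epsilon> < d1" "\<epsilon> < d2" "\<epsilon> < T - t" "\<epsilon> \<le> e / (2 * (C + 1))"
      by auto
    have "norm (v s - v t) \<le> C * (t + \<epsilon> - s) + 2 * K * \<delta>"
    proof (rule weak_derivative_increment_bound[OF v g(1) C st(1,2) \<epsilon>(1) _ K(2)])
      show "norm (v x - v s) \<le> \<delta>" if "x \<in> {s..s + \<epsilon>}" for x
        using d1(2)[of x] that \<epsilon> st by (auto simp: dist_norm)
      show "norm (v x - v t) \<le> \<delta>" if "x \<in> {t..t + \<epsilon>}" for x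
        using d2(2)[of x] that \<epsilon> st by (auto simp: dist_norm)
    qed (use \<epsilon> in simp)
    also have "2 * K * \<delta> = e / 2" using K by (simp add: \<delta>_def)
    also have "C * \<epsilon> \<le> e / 2"
    proof -
      have "C * \<epsilon> \<le> (C + 1) * \<epsilon>" using \<epsilon> by simp
      also have "\<dots> \<le> e / 2" using \<epsilon>(5) C by (simp add: field_simps)
      finally show ?thesis .
    qed
    hence "C * (t + \<epsilon> - s) + e / 2 \<le> C * (t - s) + e"
      by (simp add: algebra_simps)
    finally show "norm (v s - v t) \<le> C * (t - s) + e" .
  qed
  have "C-lipschitz_on {0<..<T} v"
  proof (rule lipschitz_onI)
    fix s t assume "s \<in> {0<..<T}" "t \<in> {0<..<T}"
    thus "dist (v s) (v t) \<le> C * dist s t"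
      using le[of s t] le[of t s] by (cases "s \<le> t") (auto simp: dist_norm norm_minus_commute)
  qed (rule C(1))
  hence "C-lipschitz_on (closure {0<..<T}) v"
    by (rule lipschitz_on_closure) (use v T in simp)
  thus ?thesis using T by auto
qed

section \<open>Error of the history operator\<close>

text \<open>On each of the \<open>j\<close> subintervals \<open>v\<close> deviates by at most \<open>L k\<close> from its value at the right end
  point.\<close>

lemma right_rectangle_rule_error:
  fixes v :: "real \<Rightarrow> 'a::banach"
  assumes L: "L-lipschitz_on {0..T} v" and k: "k \<ge> 0" and j: "real j * k \<le> T"
  shows "norm (integral {0..real j * k} v - k *\<^sub>R (\<Sum>i=1..j. v (real i * k))) \<le> real j * (L * k\<^sup>2)"
  using j
proof (induction j)
  case 0
  show ?case by simp
next
  case (Suc j)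
  define a b where "a = real j * k" and "b = real (Suc j) * k"
  have ab: "0 \<le> a" "a \<le> b" "b \<le> T" "b - a = k"
    using Suc.prems k by (auto simp: a_def b_def algebra_simps)
  have v: "continuous_on {0..T} v"
    by (rule lipschitz_on_continuous_on[OF L])
  have L0: "L \<ge> 0" by (rule lipschitz_on_nonneg[OF L])
  have int: "v integrable_on {0..b}" "v integrable_on {a..b}"
    using ab by (auto intro!: integrable_continuous_real continuous_on_subset[OF v])
  have "integral {a..b} (\<lambda>x. v x - v b) = integral {a..b} v - k *\<^sub>R v b"
    using ab int by (subst integral_diff) auto
  moreover have "norm (integral {a..b} (\<lambda>x. v x - v b)) \<le> (L * k) * (b - a)"
  proof (rule integral_bound)
    show "continuous_on {a..b} (\<lambda>x. v x - v b)"
      using ab by (intro continuous_intros continuous_on_subset[OF v]) auto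
    show "norm (v x - v b) \<le> L * k" if "x \<in> {a..b}" for x
    proof -
      have "norm (v x - v b) \<le> L * dist x b"
        using lipschitz_onD[OF L, of x b] that ab by (simp add: dist_norm)
      also have "\<dots> \<le> L * k"
        using that ab L0 by (intro mult_left_mono) (auto simp: dist_real_def)
      finally show ?thesis .
    qed
  qed (use ab in simp)
  ultimately have step: "norm (integral {a..b} v - k *\<^sub>R v b) \<le> L * k\<^sup>2"
    using ab by (simp add: power2_eq_square)
  have IH: "norm (integral {0..a} v - k *\<^sub>R (\<Sum>i=1..j. v (real i * k))) \<le> real j * (L * k\<^sup>2)"
    using Suc.IH ab by (simp add: a_def)
  have "integral {0..b} v = integral {0..a} v + integral {a..b} v"
    using Henstock_Kurzweil_Integration.integral_combine[of 0 a b v] ab int by simp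
  hence "integral {0..b} v - k *\<^sub>R (\<Sum>i=1..Suc j. v (real i * k)) =
      (integral {0..a} v - k *\<^sub>R (\<Sum>i=1..j. v (real i * k))) + (integral {a..b} v - k *\<^sub>R v b)"
    by (simp add: b_def scaleR_add_right)
  also have "norm \<dots> \<le> real j * (L * k\<^sup>2) + L * k\<^sup>2"
    by (rule norm_triangle_le) (use IH step in linarith)
  finally show ?case by (simp add: b_def algebra_simps)
qed

text \<open>The discrete history operator uses the index \<open>j - 1\<close>, whereas the continuous one integrates up to
  \<open>t\<^sub>j\<close>. Besides the quadrature error this lag leaves one term \<open>k v(t\<^sub>j)\<close>, also of order \<open>k\<close>. Errors
  of the scheme enter for earlier time steps only, which is what the discrete Gronwall inequality needs.\<close>

lemma Kop_Kdisc_error: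
  fixes v :: "real \<Rightarrow> 'v::banach"
  assumes L: "L-lipschitz_on {0..T} v" and V: "\<And>t. t \<in> {0..T} \<Longrightarrow> norm (v t) \<le> V"
    and k: "k \<ge> 0" and j: "j \<ge> 1" "real j * k \<le> T"
  shows "norm (Kop u0 v (real j * k) - Kdisc k u0h vh (j - 1))
    \<le> norm (u0 - u0h) + (T * L + V) * k + k * (\<Sum>i=1..j - 1. norm (v (real i * k) - vh i))"
proof -
  have L0: "L \<ge> 0" by (rule lipschitz_on_nonneg[OF L])
  define Q where "Q = integral {0..real j * k} v - k *\<^sub>R (\<Sum>i=1..j. v (real i * k))"
  have "norm Q \<le> real j * (L * k\<^sup>2)"
    unfolding Q_def by (rule right_rectangle_rule_error[OF L k j(2)])
  also have "\<dots> = (real j * k) * (L * k)" by (simp add: power2_eq_square)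
  also have "\<dots> \<le> T * (L * k)" using j L0 k by (intro mult_right_mono) auto
  finally have Q: "norm Q \<le> T * L * k" by (simp add: mult.assoc)
  have last: "norm (k *\<^sub>R v (real j * k)) \<le> V * k"
    using mult_left_mono[OF V k, of "real j * k"] j k by (simp add: mult.commute)
  have "{1..j} = insert j {1..j - 1}" using j by auto
  hence sum: "(\<Sum>i=1..j. v (real i * k)) = v (real j * k) + (\<Sum>i=1..j - 1. v (real i * k))"
    using j by simp
  have "Kop u0 v (real j * k) - Kdisc k u0h vh (j - 1) =
      (u0 - u0h) + (Q + k *\<^sub>R v (real j * k)) + k *\<^sub>R (\<Sum>i=1..j - 1. v (real i * k) - vh i)"
    unfolding Kop_def Kdisc_def Q_def sum sum_subtractf scaleR_add_right scaleR_diff_right by simp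
  also have "norm \<dots> \<le> norm (u0 - u0h) + (norm Q + norm (k *\<^sub>R v (real j * k)))
      + norm (k *\<^sub>R (\<Sum>i=1..j - 1. v (real i * k) - vh i))"
    by (intro norm_triangle_mono order_refl norm_triangle_ineq)
  also have "norm (k *\<^sub>R (\<Sum>i=1..j - 1. v (real i * k) - vh i))
      \<le> k * (\<Sum>i=1..j - 1. norm (v (real i * k) - vh i))"
    using k by (simp add: mult_left_mono norm_sum)
  finally show ?thesis using Q last by (simp add: algebra_simps)
qed

section \<open>Scalar inequalities\<close>

text \<open>The right-hand side of the recursive bound grows at most by the factor \<open>1 + b \<le> e\<^bsup>b\<^esup>\<close> per step.\<close>

lemma discrete_gronwall:
  fixes a :: "nat \<Rightarrow> real"
  assumes b: "b \<ge> 0" and a: "\<And>j. j \<in> {1..N} \<Longrightarrow> a j \<le> G + b * (\<Sum>i=1..j - 1. a i)"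
    and j: "j \<in> {1..N}" and G: "G \<ge> 0"
  shows "a j \<le> G * exp (real N * b)"
proof -
  have le: "G + b * (\<Sum>i=1..n. a i) \<le> G * (1 + b) ^ n" if "n \<le> N" for n
    using that
  proof (induction n)
    case (Suc n)
    have "b * a (Suc n) \<le> b * (G + b * (\<Sum>i=1..n. a i))"
      using a[of "Suc n"] Suc.prems b by (intro mult_left_mono) auto
    hence "G + b * (\<Sum>i=1..Suc n. a i) \<le> (1 + b) * (G + b * (\<Sum>i=1..n. a i))"
      by (simp add: algebra_simps)
    also have "\<dots> \<le> (1 + b) * (G * (1 + b) ^ n)"
      using Suc b by (intro mult_left_mono) auto
    finally show ?case by (simp add: mult_ac)
  qed simp
  have "a j \<le> G * (1 + b) ^ (j - 1)"
    using a[OF j] le[of "j - 1"] j by fastforce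
  also have "\<dots> \<le> G * (1 + b) ^ N"
    using j b G by (intro mult_left_mono power_increasing) auto
  also have "(1 + b) ^ N \<le> exp b ^ N"
    using b by (intro power_mono) (auto simp: exp_ge_add_one_self)
  hence "G * (1 + b) ^ N \<le> G * exp (real N * b)"
    using G by (simp add: exp_of_nat_mult mult_left_mono)
  finally show ?thesis .
qed

text \<open>Young's inequality splits the products so that those containing \<open>e\<close> use up half of \<open>m e\<^sup>2\<close>, a
  quarter for each of the two.\<close>

lemma young_absorption:
  fixes e a b r D :: real
  assumes m: "m > 0" and nonneg: "\<alpha> \<ge> 0" "\<beta> \<ge> 0" "\<delta> \<ge> 0" "\<kappa> \<ge> 0" "b \<ge> 0" "r \<ge> 0"
    and le: "m * e\<^sup>2 \<le> \<alpha> * e * a + \<beta> * D * a + \<delta> * D * e + \<kappa> * b + r"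
  shows "e\<^sup>2 \<le> 2 / m * (\<alpha>\<^sup>2 / m + \<beta> / 2 + \<delta>\<^sup>2 / m + \<kappa> + 1) * (a\<^sup>2 + b + r + D\<^sup>2)"
proof -
  have young: "x * e * y \<le> m / 4 * e\<^sup>2 + x\<^sup>2 / m * y\<^sup>2" for x y
  proof -
    have "0 \<le> m * (e / 2 - x * y / m)\<^sup>2" using m by simp
    also have "\<dots> = m / 4 * e\<^sup>2 + x\<^sup>2 / m * y\<^sup>2 - x * e * y"
      using m by (simp add: power2_eq_square field_simps)
    finally show ?thesis by simp
  qed
  define S where "S = a\<^sup>2 + b + r + D\<^sup>2"
  have S: "a\<^sup>2 \<le> S" "D\<^sup>2 \<le> S" "b \<le> S" "r \<le> S" "a\<^sup>2 + D\<^sup>2 \<le> S"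
    using nonneg by (auto simp: S_def)
  have "2 * (D * a) \<le> a\<^sup>2 + D\<^sup>2"
    using sum_squares_bound[of D a] by (simp add: mult.assoc)
  hence "\<beta> * (D * a) \<le> \<beta> * (S / 2)"
    using S nonneg by (intro mult_left_mono) auto
  moreover have "\<alpha>\<^sup>2 / m * a\<^sup>2 \<le> \<alpha>\<^sup>2 / m * S" "\<delta>\<^sup>2 / m * D\<^sup>2 \<le> \<delta>\<^sup>2 / m * S" "\<kappa> * b \<le> \<kappa> * S"
    using S nonneg m by (auto intro!: mult_left_mono divide_right_mono)
  ultimately have "m / 2 * e\<^sup>2 \<le> (\<alpha>\<^sup>2 / m + \<beta> / 2 + \<delta>\<^sup>2 / m + \<kappa> + 1) * S"
    using le young[of \<alpha> a] young[of \<delta> D] S(4) by (simp add: algebra_simps)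
  thus ?thesis
    using m unfolding S_def[symmetric] by (simp add: field_simps)
qed

lemma power2_sum3_le: "(a + b + c)\<^sup>2 \<le> 3 * (a\<^sup>2 + b\<^sup>2 + c\<^sup>2)" for a b c :: real
proof -
  have "0 \<le> (a - b)\<^sup>2 + (b - c)\<^sup>2 + (a - c)\<^sup>2" by simp
  thus ?thesis by (simp add: power2_eq_square algebra_simps)
qed

lemma power2_scaled_sum_le:
  fixes e :: "nat \<Rightarrow> real"
  assumes k: "k \<ge> 0" and n: "real n * k \<le> T"
  shows "(k * (\<Sum>i=1..n. e i))\<^sup>2 \<le> T * k * (\<Sum>i=1..n. (e i)\<^sup>2)"
proof -
  have "(\<Sum>i=1..n. e i)\<^sup>2 \<le> real n * (\<Sum>i=1..n. (e i)\<^sup>2)"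
    using Cauchy_Schwarz_ineq_sum[of "\<lambda>_. 1" e "{1..n}"] by simp
  hence "k\<^sup>2 * (\<Sum>i=1..n. e i)\<^sup>2 \<le> k\<^sup>2 * (real n * (\<Sum>i=1..n. (e i)\<^sup>2))"
    by (rule mult_left_mono) simp
  also have "\<dots> = real n * k * (k * (\<Sum>i=1..n. (e i)\<^sup>2))"
    by (simp add: power2_eq_square)
  also have "\<dots> \<le> T * (k * (\<Sum>i=1..n. (e i)\<^sup>2))"
    using k n by (intro mult_right_mono mult_nonneg_nonneg sum_nonneg) auto
  finally show ?thesis by (simp add: power_mult_distrib mult.assoc)
qed

section \<open>Error of the Galerkin scheme\<close>

text \<open>The error estimate for one time step. Here \<open>u\<close> solves the hemivariational inequality with
  functional \<open>l\<close> and potential \<open>g\<close>, while \<open>uh\<close> satisfies a perturbed one, with \<open>l'\<close> and \<open>g'\<close>,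
  in the direction \<open>w - uh\<close>, where \<open>w\<close> is to approximate \<open>u\<close>. Testing the first with \<open>uh - u\<close>
  leaves the directions \<open>\<gamma> uh - \<gamma> u\<close> and \<open>\<gamma> w - \<gamma> uh\<close> for the generalized derivatives. By subadditivity the latter splits into
  \<open>\<gamma> u - \<gamma> uh\<close>, which the one-sided Lipschitz condition on the potentials pairs with the former, and
  the approximation error \<open>\<gamma> w - \<gamma> u\<close>, which enters to the first power only.\<close>

lemma galerkin_error_inequality:
  fixes A :: "'v::real_normed_vector \<Rightarrow> 'v \<Rightarrow>\<^sub>L real" and \<gamma> :: "'v \<Rightarrow>\<^sub>L 'x::real_normed_vector"
    and l l' :: "'v \<Rightarrow>\<^sub>L real" and g g' :: "'x \<Rightarrow> real" and u uh w :: 'v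
  assumes A: "bounded_linear A" and A_bound: "\<And>z. norm (A z) \<le> \<alpha> * norm z"
    and coercive: "\<And>z. A z z \<ge> m * (norm z)\<^sup>2"
    and g': "locally_lipschitz_on UNIV g'"
    and cont: "\<And>z. A u z + l z + clarke_dderiv g (\<gamma> u) (\<gamma> z) \<ge> 0"
    and disc: "A uh (w - uh) + l' (w - uh) + clarke_dderiv g' (\<gamma> uh) (\<gamma> (w - uh)) \<ge> 0"
    and mono: "clarke_dderiv g (\<gamma> u) (\<gamma> uh - \<gamma> u) + clarke_dderiv g' (\<gamma> uh) (\<gamma> u - \<gamma> uh)
      \<le> mJ * (norm (\<gamma> u - \<gamma> uh))\<^sup>2 + q * norm (\<gamma> u - \<gamma> uh)"
    and mJ: "mJ \<ge> 0" "q \<ge> 0"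
    and growth: "\<And>z. clarke_dderiv g' (\<gamma> uh) z \<le> \<kappa> * norm z"
  shows "(m - mJ * (norm \<gamma>)\<^sup>2) * (norm (u - uh))\<^sup>2
    \<le> \<alpha> * norm (u - uh) * norm (u - w) + norm (l - l') * (norm (u - w) + norm (u - uh))
      + q * norm \<gamma> * norm (u - uh) + \<kappa> * norm (\<gamma> u - \<gamma> w) + \<bar>A u (u - w) + l (u - w)\<bar>"
proof -
  define e where "e = norm (u - uh)"
  have \<gamma>e: "norm (\<gamma> u - \<gamma> uh) \<le> norm \<gamma> * e"
    using norm_blinfun[of \<gamma> "u - uh"] by (simp add: e_def blinfun.diff_right)
  have A_diff: "A (u - uh) z = A u z - A uh z" for z
    using bounded_linear.linear[OF A, THEN linear_diff] by (simp add: blinfun.diff_left)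
  have l_diff: "(l' - l) (w - uh) \<le> norm (l - l') * (norm (u - w) + e)"
  proof -
    have "(l' - l) (w - uh) \<le> norm (l' - l) * norm (w - uh)"
      using norm_blinfun[of "l' - l" "w - uh"] by simp
    also have "\<dots> \<le> norm (l - l') * (norm (u - w) + e)"
      using norm_triangle_ineq[of "w - u" "u - uh"]
      by (intro mult_mono) (auto simp: e_def norm_minus_commute)
    finally show ?thesis .
  qed
  have A_err: "A (u - uh) (u - w) \<le> \<alpha> * e * norm (u - w)"
  proof -
    have "A (u - uh) (u - w) \<le> norm (A (u - uh)) * norm (u - w)"
      using norm_blinfun[of "A (u - uh)" "u - w"] by simp
    also have "\<dots> \<le> (\<alpha> * e) * norm (u - w)"
      unfolding e_def by (intro mult_right_mono A_bound) simp
    finally show ?thesis .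
  qed
  have cont': "A u (u - uh) + l (u - uh) \<le> clarke_dderiv g (\<gamma> u) (\<gamma> uh - \<gamma> u)"
    using cont[of "uh - u"] by (simp add: blinfun.diff_right)
  have disc': "- (A uh (w - uh) + l' (w - uh))
      \<le> clarke_dderiv g' (\<gamma> uh) (\<gamma> u - \<gamma> uh) + \<kappa> * norm (\<gamma> u - \<gamma> w)"
  proof -
    have "- (A uh (w - uh) + l' (w - uh)) \<le> clarke_dderiv g' (\<gamma> uh) ((\<gamma> u - \<gamma> uh) + (\<gamma> w - \<gamma> u))"
      using disc by (simp add: blinfun.diff_right)
    also have "\<dots> \<le> clarke_dderiv g' (\<gamma> uh) (\<gamma> u - \<gamma> uh) + clarke_dderiv g' (\<gamma> uh) (\<gamma> w - \<gamma> u)"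
      by (rule clarke_dderiv_add_le[OF g'])
    finally show ?thesis
      using growth[of "\<gamma> w - \<gamma> u"] by (simp add: norm_minus_commute)
  qed
  have "mJ * (norm (\<gamma> u - \<gamma> uh))\<^sup>2 \<le> mJ * (norm \<gamma> * e)\<^sup>2"
    using mJ \<gamma>e by (intro mult_left_mono power_mono) auto
  moreover have "q * norm (\<gamma> u - \<gamma> uh) \<le> q * (norm \<gamma> * e)"
    using mJ \<gamma>e by (intro mult_left_mono) auto
  ultimately have mono': "clarke_dderiv g (\<gamma> u) (\<gamma> uh - \<gamma> u) + clarke_dderiv g' (\<gamma> uh) (\<gamma> u - \<gamma> uh)
      \<le> mJ * (norm \<gamma>)\<^sup>2 * e\<^sup>2 + q * norm \<gamma> * e"
    using mono by (simp add: power_mult_distrib mult.assoc)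
  have "m * e\<^sup>2 \<le> A (u - uh) (u - uh)"
    unfolding e_def by (rule coercive)
  also have "\<dots> = A (u - uh) (u - w) - (A u (u - w) + l (u - w)) + (l' - l) (w - uh)
      + (A u (u - uh) + l (u - uh)) - (A uh (w - uh) + l' (w - uh))"
    by (simp add: A_diff blinfun.diff_left blinfun.diff_right algebra_simps)
  finally show ?thesis
    using A_err l_diff cont' disc' mono' unfolding e_def[symmetric] left_diff_distrib by linarith
qed

lemma discrete_solution_inequality:
  fixes A B :: "'v::banach \<Rightarrow> 'v \<Rightarrow>\<^sub>L real" and \<gamma> :: "'v \<Rightarrow>\<^sub>L 'x::banach"
  assumes A: "bounded_linear A" and sym: "\<And>u w. blinfun_apply (A u) w = blinfun_apply (A w) u"
    and J: "\<And>w. locally_lipschitz_on UNIV (J w)"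
    and sol: "discrete_solution A B J \<gamma> f Vh k N u0h vh" and Vh: "subspace Vh"
    and j: "j \<in> {1..N}" and z: "z \<in> Vh"
  defines "Wh \<equiv> Kdisc k u0h vh (j - 1)"
  shows "A (vh j) z + (B Wh - f (real j * k)) z + clarke_dderiv (J (\<gamma> Wh)) (\<gamma> (vh j)) (\<gamma> z) \<ge> 0"
proof -
  have "Ldisc A B J \<gamma> f k u0h vh j =
      (\<lambda>w. 1 / 2 * A w w + (B Wh - f (real j * k)) w + J (\<gamma> Wh) (\<gamma> w))"
    by (simp add: Ldisc_def Wh_def fun_eq_iff)
  moreover have "vh j \<in> Vh" "0 \<le> clarke_dderiv_on Vh (Ldisc A B J \<gamma> f k u0h vh j) (vh j) z"
    using sol j z by (auto simp: discrete_solution_def clarke_subdiff_on_def)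
  ultimately show ?thesis
    using clarke_dderiv_on_energy_le[OF A sym J[of "\<gamma> Wh"] Vh, where u = "vh j" and w = z
      and l = "B Wh - f (real j * k)" and \<gamma> = \<gamma>] z
    by simp
qed

theorem theorem8:
  fixes \<gamma> :: "'v::banach \<Rightarrow>\<^sub>L 'x::banach"
    and A B :: "'v \<Rightarrow> 'v \<Rightarrow>\<^sub>L real"
    and J :: "'x \<Rightarrow> 'x \<Rightarrow> real"
    and f :: "real \<Rightarrow> 'v \<Rightarrow>\<^sub>L real"
    and u0 :: 'v
    and v :: "real \<Rightarrow> 'v"
    and T mA LB c0 c1 c2 mJ1 mJ2 M :: real
  assumes "reflexive_space TYPE('v)"
    and "T > 0"
    and A_lin: "bounded_linear A"
    and A_sym: "\<And>u w. blinfun_apply (A u) w = blinfun_apply (A w) u"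
    and A_coercive: "mA > 0" "\<And>u. blinfun_apply (A u) u \<ge> mA * (norm u)\<^sup>2"
    and B_lip: "LB > 0" "\<And>u w. norm (B u - B w) \<le> LB * norm (u - w)"
    and J_lip: "\<And>w. locally_lipschitz_on UNIV (J w)"
    and J_growth: "c0 \<ge> 0" "c1 \<ge> 0" "c2 \<ge> 0"
      "\<And>w z \<xi>. \<xi> \<in> clarke_subdiff (J w) z \<Longrightarrow> norm \<xi> \<le> c0 + c1 * norm w + c2 * norm z"
    and J_mono: "mJ1 \<ge> 0" "mJ2 \<ge> 0"
      "\<And>w1 w2 v1 v2.
         clarke_dderiv (J w1) v1 (v2 - v1) + clarke_dderiv (J w2) v2 (v1 - v2)
           \<le> mJ1 * (norm (v1 - v2))\<^sup>2 + mJ2 * norm (w1 - w2) * norm (v1 - v2)"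
    and f_cont: "continuous_on {0..T} f"
    and small: "mA - 2 * mJ1 * (norm \<gamma>)\<^sup>2 > 0"
    and v_sol: "continuous_solution A B J \<gamma> f u0 T v"
    and v_reg: "W1infty 0 T v"
  shows "\<exists>c>0. \<forall>(N::nat) Vh u0h vh k.
    N \<ge> 1 \<and> k = T / real N \<and> finite_dim_subspace Vh \<and> u0h \<in> Vh \<and> norm u0h \<le> M \<and>
    discrete_solution A B J \<gamma> f Vh k N u0h vh \<longrightarrow>
    (MAX j\<in>{1..N}. (norm (v (real j * k) - vh j))\<^sup>2)
      \<le> c * (MAX j\<in>{1..N}. INF wh\<in>Vh.
               k\<^sup>2 + (norm (v (real j * k) - wh))\<^sup>2
               + norm (blinfun_apply \<gamma> (v (real j * k)) - blinfun_apply \<gamma> wh)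
               + \<bar>Rres A B f u0 v k j (v (real j * k) - wh)\<bar>)
        + c * (norm (u0 - u0h))\<^sup>2"
proof -
  define m where "m = mA - mJ1 * (norm \<gamma>)\<^sup>2"
  have "mJ1 * (norm \<gamma>)\<^sup>2 \<ge> 0" using J_mono(1) by simp
  hence m: "m > 0" using small by (simp add: m_def mult.assoc)
  have v_cont: "continuous_on {0..T} v"
    using v_sol by (simp add: continuous_solution_def)
  obtain L where L: "L-lipschitz_on {0..T} v"
    using W1infty_imp_lipschitz[OF v_cont v_reg \<open>T > 0\<close>] by blast
  have "compact (v ` {0..T})"
    by (rule compact_continuous_image[OF v_cont compact_Icc])
  then obtain V where V: "V > 0" "\<And>t. t \<in> {0..T} \<Longrightarrow> norm (v t) \<le> V"
    using compact_imp_bounded bounded_pos by (metis imageI)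
  obtain \<alpha> where \<alpha>: "\<alpha> \<ge> 0" "\<And>z. norm (A z) \<le> norm z * \<alpha>"
    using bounded_linear.nonneg_bounded[OF A_lin] by blast
  define \<rho> where "\<rho> = V * T + norm u0 + V"
  have \<rho>: "norm (v t) \<le> \<rho>" "norm (Kop u0 v t) \<le> \<rho>" if t: "t \<in> {0..T}" for t
  proof -
    have "norm (integral {0..t} v) \<le> V * (t - 0)"
      using t V(2) by (intro integral_bound continuous_on_subset[OF v_cont]) auto
    also have "\<dots> \<le> V * T" using t V(1) by simp
    finally show "norm (Kop u0 v t) \<le> \<rho>"
      using V(1) norm_triangle_ineq[of "integral {0..t} v" u0] by (simp add: Kop_def \<rho>_def)
    show "norm (v t) \<le> \<rho>"
      using V(1) V(2)[OF t] \<open>T > 0\<close> by (simp add: \<rho>_def add_increasing)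
  qed
  have \<rho>0: "\<rho> \<ge> 0" using V(1) \<open>T > 0\<close> by (simp add: \<rho>_def)
  \<comment> \<open>These coefficients collect the products of errors: the parts with \<open>c1\<close> and \<open>c2\<close> come from replacing
    the discrete solution by the exact one in the growth bound, the part with \<open>mJ2\<close> from the dependence of
    \<open>J\<close> on the history.\<close>
  define \<alpha>' where "\<alpha>' = \<alpha> + c2 * (norm \<gamma>)\<^sup>2"
  define \<beta> where "\<beta> = LB + c1 * (norm \<gamma>)\<^sup>2"
  define \<delta> where "\<delta> = LB + mJ2 * (norm \<gamma>)\<^sup>2"
  define \<kappa> where "\<kappa> = c0 + (c1 + c2) * norm \<gamma> * \<rho>"
  have coeffs: "\<alpha>' \<ge> 0" "\<beta> \<ge> 0" "\<delta> \<ge> 0" "\<kappa> \<ge> 0"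
    using \<alpha> B_lip J_growth J_mono \<rho>0 by (auto simp: \<alpha>'_def \<beta>_def \<delta>_def \<kappa>_def)
  define C1 where "C1 = 2 / m * (\<alpha>'\<^sup>2 / m + \<beta> / 2 + \<delta>\<^sup>2 / m + \<kappa> + 1)"
  have C1: "C1 > 0"
    unfolding C1_def using coeffs m
    by (intro mult_pos_pos divide_pos_pos add_nonneg_pos add_nonneg_nonneg) auto
  define P where "P = T * L + V"
  \<comment> \<open>The summand \<open>1\<close> stands for the approximation error, the others for the three parts of \<open>D\<^sup>2\<close>.\<close>
  define C2 where "C2 = C1 * (1 + 3 * P\<^sup>2 + 3 + 3 * T)"
  have C2: "C2 > 0"
    unfolding C2_def using C1 \<open>T > 0\<close> by (intro mult_pos_pos add_nonneg_pos) auto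
  define c where "c = C2 * exp (C2 * T)"
  have c: "c > 0" using C2 by (simp add: c_def)
  show ?thesis
  proof (intro exI[of _ c] conjI c allI impI, elim conjE)
    fix N :: nat and Vh u0h vh k
    assume N: "N \<ge> 1" and k_eq: "k = T / real N" and Vh: "finite_dim_subspace Vh" and u0h: "u0h \<in> Vh"
      and sol: "discrete_solution A B J \<gamma> f Vh k N u0h vh"
    have sub: "subspace Vh" using Vh by (auto simp: finite_dim_subspace_def)
    have k: "k > 0" "real N * k = T" using N \<open>T > 0\<close> by (auto simp: k_eq)
    define e where "e j = norm (v (real j * k) - vh j)" for j
    define d where "d = norm (u0 - u0h)"
    define E where "E j w = k\<^sup>2 + (norm (v (real j * k) - w))\<^sup>2
      + norm (\<gamma> (v (real j * k)) - \<gamma> w) + \<bar>Rres A B f u0 v k j (v (real j * k) - w)\<bar>" for j w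
    define X where "X = (MAX j\<in>{1..N}. INF w\<in>Vh. E j w)"
    have E_nonneg: "E j w \<ge> 0" for j w by (simp add: E_def)
    have step: "(e j)\<^sup>2 \<le> C2 * (E j w + d\<^sup>2 + k * (\<Sum>i=1..j - 1. (e i)\<^sup>2))"
      if j: "j \<in> {1..N}" and w: "w \<in> Vh" for j w
    proof -
      define t where "t = real j * k"
      define W where "W = Kop u0 v t"
      define Wh where "Wh = Kdisc k u0h vh (j - 1)"
      define D where "D = norm (W - Wh)"
      define a where "a = norm (v t - w)"
      define b where "b = norm (\<gamma> (v t) - \<gamma> w)"
      define r where "r = \<bar>Rres A B f u0 v k j (v t - w)\<bar>"
      define \<kappa>' where "\<kappa>' = c0 + c1 * norm (\<gamma> Wh) + c2 * norm (\<gamma> (vh j))"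
      have "real j * k \<le> real N * k" using j k by (intro mult_right_mono) auto
      hence t: "t \<in> {0..T}" using k by (simp add: t_def)
      have abs_nonneg: "a \<ge> 0" "b \<ge> 0" "r \<ge> 0" "D \<ge> 0" "e j \<ge> 0"
        by (auto simp: a_def b_def r_def D_def e_def)
      have "m * (e j)\<^sup>2 \<le> \<alpha> * e j * a + norm ((B W - f t) - (B Wh - f t)) * (a + e j)
          + (mJ2 * norm (\<gamma> W - \<gamma> Wh)) * norm \<gamma> * e j + \<kappa>' * b
          + \<bar>A (v t) (v t - w) + (B W - f t) (v t - w)\<bar>"
        unfolding m_def e_def a_def b_def t_def[symmetric]
      proof (rule galerkin_error_inequality[OF A_lin, where g = "J (\<gamma> W)" and g' = "J (\<gamma> Wh)"])
        show "norm (A z) \<le> \<alpha> * norm z" for z using \<alpha>(2)[of z] by (simp add: mult.commute)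
        show "0 \<le> A (v t) z + (B W - f t) z + clarke_dderiv (J (\<gamma> W)) (\<gamma> (v t)) (\<gamma> z)" for z
          using v_sol t by (auto simp: continuous_solution_def W_def blinfun.add_left blinfun.diff_left
            algebra_simps)
        show "0 \<le> A (vh j) (w - vh j) + (B Wh - f t) (w - vh j)
            + clarke_dderiv (J (\<gamma> Wh)) (\<gamma> (vh j)) (\<gamma> (w - vh j))"
          unfolding Wh_def t_def
        proof (rule discrete_solution_inequality[OF A_lin A_sym J_lip sol sub j])
          have "vh j \<in> Vh" using sol j by (simp add: discrete_solution_def)
          thus "w - vh j \<in> Vh" using w sub by (simp add: subspace_diff)
        qed
        show "clarke_dderiv (J (\<gamma> Wh)) (\<gamma> (vh j)) z \<le> \<kappa>' * norm z" for z
          unfolding \<kappa>'_def by (rule clarke_dderiv_le_subdiff_bound[OF J_lip J_growth(4)])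
      qed (use A_coercive J_lip J_mono in auto)
      also have "norm ((B W - f t) - (B Wh - f t)) * (a + e j) \<le> LB * D * (a + e j)"
        using B_lip(2)[of W Wh] abs_nonneg by (intro mult_right_mono) (auto simp: D_def)
      also have "mJ2 * norm (\<gamma> W - \<gamma> Wh) * norm \<gamma> * e j \<le> mJ2 * (norm \<gamma> * D) * norm \<gamma> * e j"
        using norm_blinfun[of \<gamma> "W - Wh"] J_mono(2) abs_nonneg
        by (intro mult_right_mono mult_left_mono) (auto simp: D_def blinfun.diff_right)
      \<comment> \<open>The growth bound at the discrete solution is traded for the one at the exact solution; the
        difference consists of products of errors, to be split by Young's inequality.\<close>
      also have "\<kappa>' * b \<le> \<kappa> * b + (c1 * norm \<gamma> * D + c2 * norm \<gamma> * e j) * (norm \<gamma> * a)"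
      proof -
        have "norm (\<gamma> Wh) \<le> norm \<gamma> * (\<rho> + D)"
        proof -
          have "norm Wh \<le> \<rho> + D"
            using \<rho>(2)[OF t] norm_triangle_ineq4[of W "W - Wh"] by (simp add: D_def W_def)
          thus ?thesis
            using norm_blinfun[of \<gamma> Wh] by (meson mult_left_mono norm_ge_zero order_trans)
        qed
        moreover have "norm (\<gamma> (vh j)) \<le> norm \<gamma> * (\<rho> + e j)"
        proof -
          have "norm (vh j) \<le> \<rho> + e j"
            using \<rho>(1)[OF t] norm_triangle_ineq4[of "v t" "v t - vh j"] by (simp add: e_def t_def)
          thus ?thesis
            using norm_blinfun[of \<gamma> "vh j"] by (meson mult_left_mono norm_ge_zero order_trans)
        qed
        ultimately have "\<kappa>' \<le> c0 + c1 * (norm \<gamma> * (\<rho> + D)) + c2 * (norm \<gamma> * (\<rho> + e j))"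
          unfolding \<kappa>'_def using J_growth by (intro add_mono mult_left_mono) auto
        also have "\<dots> = \<kappa> + (c1 * norm \<gamma> * D + c2 * norm \<gamma> * e j)"
          by (simp add: \<kappa>_def algebra_simps)
        finally have "\<kappa>' * b \<le> (\<kappa> + (c1 * norm \<gamma> * D + c2 * norm \<gamma> * e j)) * b"
          using abs_nonneg by (intro mult_right_mono)
        also have "\<dots> = \<kappa> * b + (c1 * norm \<gamma> * D + c2 * norm \<gamma> * e j) * b"
          by (rule distrib_right)
        also have "(c1 * norm \<gamma> * D + c2 * norm \<gamma> * e j) * b
            \<le> (c1 * norm \<gamma> * D + c2 * norm \<gamma> * e j) * (norm \<gamma> * a)"
        proof (rule mult_left_mono)
          show "b \<le> norm \<gamma> * a"
            using norm_blinfun[of \<gamma> "v t - w"] by (simp add: a_def b_def blinfun.diff_right)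
          show "0 \<le> c1 * norm \<gamma> * D + c2 * norm \<gamma> * e j"
            using J_growth(2,3) abs_nonneg by simp
        qed
        finally show ?thesis by simp
      qed
      also have "\<bar>A (v t) (v t - w) + (B W - f t) (v t - w)\<bar> = r"
        by (simp add: r_def Rres_def W_def t_def blinfun.diff_left algebra_simps)
      finally have "m * (e j)\<^sup>2 \<le> \<alpha>' * e j * a + \<beta> * D * a + \<delta> * D * e j + \<kappa> * b + r"
        by (simp add: \<alpha>'_def \<beta>_def \<delta>_def power2_eq_square algebra_simps)
      from young_absorption[OF m coeffs abs_nonneg(2,3) this]
      have e_le: "(e j)\<^sup>2 \<le> C1 * (a\<^sup>2 + b + r + D\<^sup>2)" by (simp add: C1_def)
      have jT: "real j * k \<le> T" "real (j - 1) * k \<le> T"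
        using t k j by (auto simp: t_def of_nat_diff algebra_simps)
      define S where "S = (\<Sum>i=1..j - 1. (e i)\<^sup>2)"
      have S: "S \<ge> 0" by (simp add: S_def sum_nonneg)
      have "D \<le> d + P * k + k * (\<Sum>i=1..j - 1. e i)"
        unfolding D_def W_def Wh_def t_def d_def P_def e_def
        using V(2) k j jT by (intro Kop_Kdisc_error[OF L]) auto
      hence "D\<^sup>2 \<le> (d + P * k + k * (\<Sum>i=1..j - 1. e i))\<^sup>2"
        using abs_nonneg by (intro power_mono)
      also have "\<dots> \<le> 3 * (d\<^sup>2 + (P * k)\<^sup>2 + (k * (\<Sum>i=1..j - 1. e i))\<^sup>2)"
        by (rule power2_sum3_le)
      also have "(k * (\<Sum>i=1..j - 1. e i))\<^sup>2 \<le> T * k * S"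
        unfolding S_def using k jT by (intro power2_scaled_sum_le) auto
      finally have D_le: "D\<^sup>2 \<le> 3 * d\<^sup>2 + 3 * P\<^sup>2 * k\<^sup>2 + 3 * T * (k * S)"
        by (simp add: power_mult_distrib algebra_simps)
      define Y where "Y = E j w + d\<^sup>2 + k * S"
      have Y_eq: "Y = k\<^sup>2 + a\<^sup>2 + b + r + d\<^sup>2 + k * S"
        by (simp add: Y_def E_def a_def b_def r_def t_def)
      have kS: "k * S \<ge> 0" using k S by simp
      have Y: "a\<^sup>2 + b + r \<le> Y" "d\<^sup>2 \<le> Y" "k\<^sup>2 \<le> Y" "k * S \<le> Y"
        using abs_nonneg kS by (auto simp: Y_eq)
      have "3 * P\<^sup>2 * k\<^sup>2 \<le> 3 * P\<^sup>2 * Y" "3 * T * (k * S) \<le> 3 * T * Y"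
        using Y \<open>T > 0\<close> by (auto intro!: mult_left_mono)
      hence "a\<^sup>2 + b + r + D\<^sup>2 \<le> (1 + 3 * P\<^sup>2 + 3 + 3 * T) * Y"
        using D_le Y(1,2) by (simp add: algebra_simps)
      hence "C1 * (a\<^sup>2 + b + r + D\<^sup>2) \<le> C2 * Y"
        using C1 by (simp add: C2_def mult.assoc)
      with e_le show ?thesis by (simp add: Y_def S_def)
    qed
    have INF_le: "(e j)\<^sup>2 \<le> C2 * (X + d\<^sup>2) + C2 * k * (\<Sum>i=1..j - 1. (e i)\<^sup>2)" if j: "j \<in> {1..N}" for j
    proof -
      define S where "S = (\<Sum>i=1..j - 1. (e i)\<^sup>2)"
      have "(e j)\<^sup>2 / C2 - d\<^sup>2 - k * S \<le> (INF w\<in>Vh. E j w)"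
      proof (rule cINF_greatest)
        show "Vh \<noteq> {}" using u0h by blast
        show "(e j)\<^sup>2 / C2 - d\<^sup>2 - k * S \<le> E j w" if "w \<in> Vh" for w
          using step[OF j that] C2 by (simp add: S_def field_simps)
      qed
      also have "\<dots> \<le> X" unfolding X_def using j by (intro Max_ge) auto
      finally show ?thesis using C2 by (simp add: S_def field_simps)
    qed
    have X0: "X \<ge> 0"
    proof -
      have "0 \<le> (INF w\<in>Vh. E 1 w)" using u0h E_nonneg by (intro cINF_greatest) auto
      also have "\<dots> \<le> X" unfolding X_def using N by (intro Max_ge) auto
      finally show ?thesis .
    qed
    have "(e j)\<^sup>2 \<le> c * (X + d\<^sup>2)" if j: "j \<in> {1..N}" for j
    proof -
      have "(e j)\<^sup>2 \<le> C2 * (X + d\<^sup>2) * exp (real N * (C2 * k))"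
        using C2 k X0 by (intro discrete_gronwall[OF _ INF_le j]) auto
      also have "real N * (C2 * k) = C2 * T" using k by (simp add: algebra_simps)
      finally show ?thesis by (simp add: c_def algebra_simps)
    qed
    hence "(MAX j\<in>{1..N}. (e j)\<^sup>2) \<le> c * (X + d\<^sup>2)"
      using N by (intro Max.boundedI) auto
    thus "(MAX j\<in>{1..N}. (norm (v (real j * k) - vh j))\<^sup>2)
      \<le> c * (MAX j\<in>{1..N}. INF wh\<in>Vh.
               k\<^sup>2 + (norm (v (real j * k) - wh))\<^sup>2
               + norm (blinfun_apply \<gamma> (v (real j * k)) - blinfun_apply \<gamma> wh)
               + \<bar>Rres A B f u0 v k j (v (real j * k) - wh)\<bar>)
        + c * (norm (u0 - u0h))\<^sup>2"
      by (simp add: e_def X_def E_def d_def distrib_left)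
  qed
qed

end
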